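(* Let $\mathbf{Z}=(Z_n)_{n\ge 0}$ be the balanced excited random walk in $2=1+1$ dimensions and let $R_n=\#\{Z_0,\dots,Z_n\}$. Then, as $n\to\infty$, (i) for any sequence $a_n\to\infty$, $\ \mathbb{P}\Big(R_n>\dfrac{n\,a_n}{\sqrt{\log\log n}}\Big)\to 0$; and (ii) $\ \mathbb{P}\big(R_n\ge n^{4/7}/(\log n)^2\big)\to 1$.
   Context: The balanced excited random walk (BERW) in $2=1+1$ dimensions is the following nearest-neighbour walk $\mathbf{Z}=(Z_n)_{n\ge0}$ on $\mathbb{Z}^2$ started at $Z_0=(0,0)$. On the first departure from each site, the walk makes a vertical step ($\pm(0,1)$); on all subsequent departures from that site, it makes a horizontal step ($\pm(1,0)$). In each case the step is to one of the two corresponding neighbours with probability $1/2$ each, independently of all previous randomness. $\log$ is the natural logarithm. *)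

theory Defs
  imports "HOL-Probability.Probability"
begin

(* Law of the next site of the walk when its trajectory up to time n is z 0, ..., z n.
   The departure at time n is the first one from the site z n iff z n was not visited
   strictly before time n. *)
definition berw_kernel :: "(nat \<Rightarrow> int \<times> int) \<Rightarrow> nat \<Rightarrow> (int \<times> int) pmf" where
  "berw_kernel z n =
     (if z n \<notin> z ` {..<n}
      then pmf_of_set {z n + (0, 1), z n - (0, 1)}
      else pmf_of_set {z n + (1, 0), z n - (1, 0)})"

(* The walk is specified through its law only, so Z may live on any probability space.
   In step_law only the values z 0, ..., z (Suc n) of z matter. *)
locale balanced_excited_random_walk = prob_space M
  for M :: "'a measure" +
  fixes Z :: "nat \<Rightarrow> 'a \<Rightarrow> int \<times> int"
  assumes random_variable_Z: "\<And>n. random_variable (count_space UNIV) (Z n)"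
    and start: "AE \<omega> in M. Z 0 \<omega> = (0, 0)"
    and step_law: "\<And>n z. \<P>(\<omega> in M. \<forall>i\<le>n. Z i \<omega> = z i) > 0 \<Longrightarrow>
      \<P>(\<omega> in M. Z (Suc n) \<omega> = z (Suc n) \<bar> \<forall>i\<le>n. Z i \<omega> = z i)
        = pmf (berw_kernel z n) (z (Suc n))"

definition walk_range :: "(nat \<Rightarrow> 'a \<Rightarrow> int \<times> int) \<Rightarrow> nat \<Rightarrow> 'a \<Rightarrow> nat" where
  "walk_range Z n \<omega> = card ((\<lambda>i. Z i \<omega>) ` {0..n})"

end

theory Submission
  imports Defs "HOL-Real_Asymp.Real_Asymp"
begin

text \<open>
  \<^emph>\<open>Upper bound.\<close> Whatever the past, both coordinates stay in a box of side \<open>sqrt (\<epsilon> d)\<close> during \<open>d\<close> steps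
  with probability at least \<open>exp (- 40 / \<epsilon>)\<close>, and then at most \<open>\<epsilon> d\<close> sites are visited. There are
  logarithmically many independent scales, so from most times on, such a block occurs at some scale, and
  the trajectory can be covered by windows that contain few sites compared to their length.

  \<^emph>\<open>Lower bound.\<close> The number of visited sites is at least the number of vertical steps. Fix the vertical
  trajectory and consider \<open>q ^ 4\<close> vertical steps in \<open>q\<close> windows of \<open>q ^ 3\<close> steps. Up to logarithms every level
  has at most \<open>L = q\<^sup>2\<close> visited sites, at most \<open>b = q powr (3 / 2)\<close> of them new in the current window. Between
  two vertical steps the walk exits an interval of visited sites. Intervals of length at most \<open>2 b\<close> cost time
  \<open>b\<^sup>2\<close>. Longer ones lie in a set \<open>S\<close> of at most \<open>5 L\<close> sites that is determined at the start of the window. Let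
  \<open>D\<close> be the mean distance between the horizontal coordinates of two independent copies of the walk with the
  same vertical trajectory. If \<open>u\<close> is the mean time spent in long intervals between two vertical steps, then
  \<open>u\<^sup>2\<close> is at most \<open>2 (card S)\<^sup>3\<close> times the increment of \<open>D\<close>. As \<open>D\<close> is at most twice the root of the mean
  duration \<open>V\<close> of the window, the Cauchy-Schwarz inequality gives \<open>V\<^sup>2 \<le> C q\<^sup>3 L\<^sup>3 sqrt V\<close>, that is, \<open>V \<le> C q\<^sup>6\<close>. Hence
  \<open>q ^ 4\<close> vertical steps take a time of order \<open>q ^ 7\<close>, up to logarithms.
\<close>

section \<open>The law of the trajectory\<close>

definition dir :: "(int \<times> int) set \<Rightarrow> int \<times> int \<Rightarrow> int \<times> int" where
  "dir A p = (if p \<in> A then (1, 0) else (0, 1))"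

text \<open>The set \<open>A\<close> of sites departed from earlier, together with the current site,
  is a Markov state. Having both as arguments allows bounds that are uniform over the past.\<close>

fun walk :: "nat \<Rightarrow> (int \<times> int) set \<Rightarrow> int \<times> int \<Rightarrow> (int \<times> int) list pmf" where
  "walk 0 A p = return_pmf [p]"
| "walk (Suc n) A p = bind_pmf (pmf_of_set {p + dir A p, p - dir A p})
     (\<lambda>p'. map_pmf (Cons p) (walk n (insert p A) p'))"

lemma add_dir_neq: "p + dir A p \<noteq> p - dir A p"
proof
  assume eq: "p + dir A p = p - dir A p"
  have "fst (p + dir A p) = fst (p - dir A p)" "snd (p + dir A p) = snd (p - dir A p)"
    using eq by (simp_all only:)
  then have "fst (dir A p) = 0" "snd (dir A p) = 0"
    by (simp_all only: fst_add fst_diff snd_add snd_diff)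
  then show False
    by (simp add: dir_def split: if_splits)
qed

lemma berw_kernel_eq:
  "berw_kernel z n = pmf_of_set {z n + dir (z ` {..<n}) (z n), z n - dir (z ` {..<n}) (z n)}"
  by (simp add: berw_kernel_def dir_def)

text \<open>First-step analysis; the two targets differ, so each has weight 1/2. Later inductions on
  probabilities under \<open>walk\<close> unfold through this equation.\<close>

lemma prob_walk_Suc:
  "measure_pmf.prob (walk (Suc n) A p) {xs. Q xs} =
     (measure_pmf.prob (walk n (insert p A) (p + dir A p)) {xs. Q (p # xs)} +
      measure_pmf.prob (walk n (insert p A) (p - dir A p)) {xs. Q (p # xs)}) / 2"
proof -
  have "measure_pmf.prob (walk (Suc n) A p) {xs. Q xs} =
    measure_pmf.expectation (pmf_of_set {p + dir A p, p - dir A p})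
      (\<lambda>p'. measure_pmf.prob (map_pmf (Cons p) (walk n (insert p A) p')) {xs. Q xs})"
    by (simp add: measure_pmf_bind measure_pmf.measure_bind[where N = "count_space UNIV"]
        space_subprob_algebra_empty_iff measure_pmf_in_subprob_algebra)
  also have "\<dots> = (\<Sum>p'\<in>{p + dir A p, p - dir A p}.
      measure_pmf.prob (map_pmf (Cons p) (walk n (insert p A) p')) {xs. Q xs}) / 2"
    using add_dir_neq[of p A] by (subst integral_pmf_of_set) auto
  finally show ?thesis
    using add_dir_neq[of p A] by (simp add: measure_map_pmf vimage_def)
qed

lemma length_walk: "xs \<in> set_pmf (walk n A p) \<Longrightarrow> length xs = Suc n"
proof (induction n arbitrary: A p xs)
  case (Suc n)
  then have "\<exists>p' ys. xs = p # ys \<and> ys \<in> set_pmf (walk n (insert p A) p')"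
    unfolding walk.simps set_bind_pmf set_map_pmf by blast
  then show ?case
    using Suc.IH by (metis length_Cons)
qed simp

lemma prob_walk_cong:
  assumes "\<And>xs. length xs = Suc n \<Longrightarrow> Q xs \<longleftrightarrow> Q' xs"
  shows "measure_pmf.prob (walk n A p) {xs. Q xs} = measure_pmf.prob (walk n A p) {xs. Q' xs}"
proof (rule measure_prob_cong_0)
  fix xs assume "xs \<in> {xs. Q xs} - {xs. Q' xs}"
  then show "pmf (walk n A p) xs = 0"
    using length_walk[of xs n A p] assms[of xs] by (auto simp: set_pmf_iff)
next
  fix xs assume "xs \<in> {xs. Q' xs} - {xs. Q xs}"
  then show "pmf (walk n A p) xs = 0"
    using length_walk[of xs n A p] assms[of xs] by (auto simp: set_pmf_iff)
qed

lemma prob_walk_mono: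
  assumes "\<And>xs. length xs = Suc n \<Longrightarrow> Q xs \<Longrightarrow> Q' xs"
  shows "measure_pmf.prob (walk n A p) {xs. Q xs} \<le> measure_pmf.prob (walk n A p) {xs. Q' xs}"
proof -
  have "measure_pmf.prob (walk n A p) {xs. Q xs} =
      measure_pmf.prob (walk n A p) {xs. length xs = Suc n \<and> Q xs}"
    by (rule prob_walk_cong) auto
  also have "\<dots> \<le> measure_pmf.prob (walk n A p) {xs. Q' xs}"
    using assms by (intro measure_pmf.finite_measure_mono) auto
  finally show ?thesis .
qed

lemma pmf_walk_Cons:
  "pmf (walk (Suc n) A p) (x # xs) = of_bool (x = p) *
     (pmf (walk n (insert p A) (p + dir A p)) xs + pmf (walk n (insert p A) (p - dir A p)) xs) / 2"
proof -
  have "pmf (walk (Suc n) A p) (x # xs) = measure_pmf.prob (walk (Suc n) A p) {ys. ys = x # xs}"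
    by (simp add: measure_pmf_single)
  also have "\<dots> = of_bool (x = p) *
     (pmf (walk n (insert p A) (p + dir A p)) xs + pmf (walk n (insert p A) (p - dir A p)) xs) / 2"
    by (subst prob_walk_Suc, cases "x = p") (auto simp: measure_pmf_single)
  finally show ?thesis .
qed

text \<open>\<open>walk\<close> branches on the first step, whereas \<open>step_law\<close> speaks
  of the last one. This puts the mass of a trajectory into the second form.\<close>

lemma pmf_walk_snoc:
  assumes "length xs = Suc n"
  shows "pmf (walk (Suc n) A p) (xs @ [y]) = pmf (walk n A p) xs *
     pmf (pmf_of_set {last xs + dir (A \<union> set (butlast xs)) (last xs),
                      last xs - dir (A \<union> set (butlast xs)) (last xs)}) y"
  using assms
proof (induction n arbitrary: A p xs)
  case 0
  then obtain x where xs: "xs = [x]"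
    by (cases xs) auto
  show ?case
    using add_dir_neq[of p A] unfolding xs append.simps pmf_walk_Cons
    by (auto simp: pmf_of_set indicator_def)
next
  case (Suc n)
  then obtain x ys where xs: "xs = x # ys" and ys: "length ys = Suc n"
    by (cases xs) auto
  have ne: "ys \<noteq> []"
    using ys by auto
  show ?case
    using ne unfolding xs append.simps pmf_walk_Cons[of "Suc n"] pmf_walk_Cons[of n] Suc.IH[OF ys]
    by (auto simp: algebra_simps add_divide_distrib)
qed

section \<open>The law of the given process\<close>

context balanced_excited_random_walk
begin

definition path :: "nat \<Rightarrow> 'a \<Rightarrow> (int \<times> int) list" where
  "path n \<omega> = map (\<lambda>i. Z i \<omega>) [0..<Suc n]"

lemma measurable_path: "random_variable (count_space UNIV) (path n)"
proof -
  have "path n -` {xs} \<inter> space M = {\<omega> \<in> space M. length xs = Suc n \<and> (\<forall>i\<le>n. Z i \<omega> = xs ! i)}" for xs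
    by (auto simp: path_def list_eq_iff_nth_eq less_Suc_eq_le simp del: upt_Suc)
  then have eq: "path n -` {xs} \<inter> space M =
      (if length xs = Suc n then {\<omega> \<in> space M. \<forall>i\<in>{..n}. Z i \<omega> = xs ! i} else {})" for xs
    by (simp add: Ball_def)
  have single: "{\<omega> \<in> space M. Z i \<omega> = c} \<in> events" for i c
    using measurable_sets[OF random_variable_Z, of "{c}" i] by (simp add: vimage_def Int_def conj_commute)
  have "{\<omega> \<in> space M. \<forall>i\<in>{..n}. Z i \<omega> = xs ! i} \<in> events" for xs
    by (intro sets.sets_Collect_finite_All single) auto
  then have "path n -` {xs} \<inter> space M \<in> events" for xs
    unfolding eq by simp
  then show ?thesis
    by (subst measurable_count_space_eq_countable[OF countableI_type]) auto
qed

lemma prob_path_single: "prob {\<omega> \<in> space M. path n \<omega> = xs} = pmf (walk n {} (0, 0)) xs"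
proof (induction n arbitrary: xs)
  case 0
  have "prob {\<omega> \<in> space M. path 0 \<omega> = xs} = prob {\<omega> \<in> space M. xs = [(0, 0)]}"
    using start random_variable_Z[of 0]
    by (intro finite_measure_eq_AE) (auto simp: path_def intro: measurable_sets)
  then show ?case
    by (simp add: prob_space pmf_return indicator_def)
next
  case (Suc n)
  show ?case
  proof (cases "length xs = Suc (Suc n)")
    case False
    then have "pmf (walk (Suc n) {} (0, 0)) xs = 0"
      using length_walk[of xs "Suc n" "{}" "(0, 0)"] by (auto simp: set_pmf_iff simp del: walk.simps)
    moreover have "{\<omega> \<in> space M. path (Suc n) \<omega> = xs} = {}"
      using False by (auto simp: path_def)
    ultimately show ?thesis
      by (metis measure_empty)
  next
    case True
    then obtain ys y where xs: "xs = ys @ [y]" and ys: "length ys = Suc n"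
      by (metis length_Suc_conv_rev)
    define z where "z i = (ys @ [y]) ! i" for i
    have path_iff: "path n \<omega> = ys \<longleftrightarrow> (\<forall>i\<le>n. Z i \<omega> = z i)" for \<omega>
      using ys by (auto simp: path_def list_eq_iff_nth_eq less_Suc_eq_le z_def nth_append simp del: upt_Suc)
    have path_iff': "path (Suc n) \<omega> = xs \<longleftrightarrow> Z (Suc n) \<omega> = z (Suc n) \<and> path n \<omega> = ys" for \<omega>
      using ys unfolding xs by (auto simp: path_def z_def nth_append)
    have last: "last ys = z n"
      using ys last_conv_nth[of ys] by (simp add: z_def nth_append flip: length_greater_0_conv)
    have img: "set (butlast ys) = z ` {..<n}"
    proof -
      have "butlast ys = map z [0..<n]"
        using ys by (intro nth_equalityI) (simp_all add: nth_butlast z_def nth_append)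
      then show ?thesis
        by (simp add: atLeast0LessThan)
    qed
    have kernel: "pmf (walk (Suc n) {} (0, 0)) xs =
        pmf (walk n {} (0, 0)) ys * pmf (berw_kernel z n) (z (Suc n))"
      using ys unfolding xs pmf_walk_snoc[OF ys] berw_kernel_eq last img
      by (simp add: z_def nth_append)
    have IH: "prob {\<omega> \<in> space M. \<forall>i\<le>n. Z i \<omega> = z i} = pmf (walk n {} (0, 0)) ys"
      using Suc.IH[of ys] by (simp add: path_iff)
    show ?thesis
    proof (cases "prob {\<omega> \<in> space M. \<forall>i\<le>n. Z i \<omega> = z i} > 0")
      case True
      then show ?thesis
        using step_law[OF True] IH unfolding path_iff' kernel path_iff cond_prob_def
        by (simp add: field_simps)
    next
      \<comment> \<open>\<open>step_law\<close> is silent about a past of probability zero; then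
        both sides vanish.\<close>
      case False
      then have 0: "prob {\<omega> \<in> space M. \<forall>i\<le>n. Z i \<omega> = z i} = 0"
        by (simp add: not_less measure_le_0_iff)
      have "prob {\<omega> \<in> space M. path (Suc n) \<omega> = xs} \<le> prob {\<omega> \<in> space M. \<forall>i\<le>n. Z i \<omega> = z i}"
        using measurable_sets[OF measurable_path, of "{ys}" n]
        unfolding path_iff[symmetric] path_iff'
        by (intro finite_measure_mono) (auto simp: vimage_def Int_def conj_commute)
      then show ?thesis
        using 0 IH kernel by (simp add: measure_le_0_iff)
    qed
  qed
qed

text \<open>There are countably many trajectories, so equal masses mean equal laws. All estimates
  below can therefore be made for \<open>walk\<close>.\<close>

lemma prob_path: "prob {\<omega> \<in> space M. Q (path n \<omega>)} = measure_pmf.prob (walk n {} (0, 0)) {xs. Q xs}"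
proof -
  have "distr M (count_space UNIV) (path n) = measure_pmf (walk n {} (0, 0))"
  proof (rule measure_eqI_countable[where A = UNIV])
    fix xs
    have "emeasure (distr M (count_space UNIV) (path n)) {xs} = prob {\<omega> \<in> space M. path n \<omega> = xs}"
      using measurable_path[of n]
      by (subst emeasure_distr) (auto simp: emeasure_eq_measure vimage_def Int_def conj_commute)
    then show "emeasure (distr M (count_space UNIV) (path n)) {xs} = emeasure (measure_pmf (walk n {} (0, 0))) {xs}"
      by (simp add: prob_path_single emeasure_pmf_single)
  qed (auto intro: countableI_type)
  then have "measure_pmf.prob (walk n {} (0, 0)) {xs. Q xs} = measure (distr M (count_space UNIV) (path n)) {xs. Q xs}"
    by simp
  also have "\<dots> = prob {\<omega> \<in> space M. Q (path n \<omega>)}"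
    using measurable_path[of n] by (subst measure_distr) (auto simp: vimage_def Int_def conj_commute)
  finally show ?thesis ..
qed

lemma walk_range_eq: "walk_range Z n \<omega> = card (set (path n \<omega>))"
  by (simp add: walk_range_def path_def atLeast0LessThan[symmetric] atLeastLessThanSuc_atLeastAtMost del: upt_Suc)

end

section \<open>The upper bound\<close>

lemma prob_walk_drop_le:
  assumes "\<And>A p. measure_pmf.prob (walk m A p) {xs. Q xs} \<le> c"
  shows "measure_pmf.prob (walk (s + m) A p) {xs. Q (drop s xs)} \<le> c"
proof (induction s arbitrary: A p)
  case 0
  then show ?case
    using assms by simp
next
  case (Suc s)
  show ?case
    unfolding add_Suc prob_walk_Suc drop_Suc_Cons
    using Suc.IH[of "insert p A" "p + dir A p"] Suc.IH[of "insert p A" "p - dir A p"] by simp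
qed

text \<open>A bound for the future that holds from every state multiplies the probability of any
  event of the first \<open>d\<close> sites.\<close>

lemma prob_walk_take_drop_le:
  fixes P :: "(int \<times> int) list \<Rightarrow> bool"
  assumes "\<And>A p. measure_pmf.prob (walk m A p) {xs. Q xs} \<le> c"
  shows "measure_pmf.prob (walk (d + m) A p) {xs. P (take d xs) \<and> Q (drop d xs)}
           \<le> c * measure_pmf.prob (walk (d + m) A p) {xs. P (take d xs)}"
proof (induction d arbitrary: A p P)
  case 0
  then show ?case
    using assms by (cases "P []") simp_all
next
  case (Suc d)
  show ?case
    unfolding add_Suc prob_walk_Suc drop_Suc_Cons take_Suc_Cons
    using Suc.IH[of "insert p A" "p + dir A p" "\<lambda>xs. P (p # xs)"]
      Suc.IH[of "insert p A" "p - dir A p" "\<lambda>xs. P (p # xs)"] by (simp add: field_simps)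
qed

text \<open>The product of cosines below vanishes on the boundary of the box and is an eigenfunction of
  each of the two one-dimensional averaging operators, so it does not matter which one the walk uses.\<close>

lemma prob_confined_ge:
  fixes w a b :: int
  defines "\<phi> \<equiv> \<lambda>u. cos (pi / (2 * real_of_int w) * real_of_int u)"
  assumes "w > 0" and "\<bar>fst p - a\<bar> \<le> w" and "\<bar>snd p - b\<bar> \<le> w"
  shows "cos (pi / (2 * real_of_int w)) ^ d * (\<phi> (fst p - a) * \<phi> (snd p - b)) \<le>
     measure_pmf.prob (walk (d + m) A p) {xs. \<forall>z\<in>set (take d xs). \<bar>fst z - a\<bar> < w \<and> \<bar>snd z - b\<bar> < w}"
  using assms(3,4)
proof (induction d arbitrary: A p)
  case 0
  have "\<bar>\<phi> u * \<phi> v\<bar> \<le> 1" for u v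
    unfolding \<phi>_def abs_mult by (intro mult_le_one) auto
  then have "\<phi> u * \<phi> v \<le> 1" for u v
    by (rule abs_le_D1)
  then show ?case
    by simp
next
  case (Suc d)
  define \<theta> where "\<theta> = pi / (2 * real_of_int w)"
  have nonneg: "\<phi> u \<ge> 0" if "\<bar>u\<bar> \<le> w" for u
  proof -
    have "\<bar>real_of_int u\<bar> \<le> real_of_int w"
      using that by (metis of_int_abs of_int_le_iff)
    then have "\<bar>\<theta> * real_of_int u\<bar> \<le> pi / 2"
      using \<open>w > 0\<close> by (simp add: \<theta>_def abs_mult field_simps)
    then show ?thesis
      unfolding \<phi>_def \<theta>_def[symmetric] by (intro cos_ge_zero) linarith+
  qed
  have zero: "\<phi> u = 0" if "\<bar>u\<bar> = w" for u
  proof -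
    have "u = w \<or> u = - w"
      using that by linarith
    then show ?thesis
      using \<open>w > 0\<close> by (auto simp: \<phi>_def)
  qed
  have avg: "(\<phi> (u + 1) + \<phi> (u - 1)) / 2 = cos \<theta> * \<phi> u" for u
    unfolding \<phi>_def \<theta>_def[symmetric] by (simp add: distrib_left right_diff_distrib cos_add cos_diff)
  let ?Q = "\<lambda>xs. \<forall>z\<in>set (take d xs). \<bar>fst z - a\<bar> < w \<and> \<bar>snd z - b\<bar> < w"
  show ?case
  proof (cases "\<bar>fst p - a\<bar> < w \<and> \<bar>snd p - b\<bar> < w")
    \<comment> \<open>The starting site is then on the boundary of the box, where one of the cosine
      factors vanishes.\<close>
    case False
    then have "\<phi> (fst p - a) * \<phi> (snd p - b) = 0"
      using Suc.prems zero by (metis linorder_neqE_linordered_idom linorder_not_less mult_zero_left mult_zero_right)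
    then show ?thesis
      by (simp only: mult_zero_right measure_nonneg)
  next
    case True
    define p1 p2 where "p1 = p + dir A p" and "p2 = p - dir A p"
    have prems: "\<bar>fst p1 - a\<bar> \<le> w" "\<bar>snd p1 - b\<bar> \<le> w" "\<bar>fst p2 - a\<bar> \<le> w" "\<bar>snd p2 - b\<bar> \<le> w"
    proof -
      have "\<bar>fst (dir A p)\<bar> \<le> 1" "\<bar>snd (dir A p)\<bar> \<le> 1"
        by (simp_all add: dir_def)
      then show "\<bar>fst p1 - a\<bar> \<le> w" "\<bar>snd p1 - b\<bar> \<le> w" "\<bar>fst p2 - a\<bar> \<le> w" "\<bar>snd p2 - b\<bar> \<le> w"
        using True unfolding p1_def p2_def fst_add snd_add fst_diff snd_diff by linarith+
    qed
    define X where "X = \<phi> (fst p - a) * \<phi> (snd p - b)"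
    define X1 X2 where "X1 = \<phi> (fst p1 - a) * \<phi> (snd p1 - b)" and "X2 = \<phi> (fst p2 - a) * \<phi> (snd p2 - b)"
    have avg_product: "(X1 + X2) / 2 = cos \<theta> * X"
    proof (cases "p \<in> A")
      case True
      then have "fst p1 - a = fst p - a + 1" "fst p2 - a = fst p - a - 1" "snd p1 = snd p" "snd p2 = snd p"
        by (simp_all add: p1_def p2_def dir_def)
      then have "(X1 + X2) / 2 = (\<phi> (fst p - a + 1) + \<phi> (fst p - a - 1)) / 2 * \<phi> (snd p - b)"
        by (simp only: X1_def X2_def distrib_right times_divide_eq_left)
      then show ?thesis
        by (simp only: avg X_def mult.assoc)
    next
      case False
      then have "snd p1 - b = snd p - b + 1" "snd p2 - b = snd p - b - 1" "fst p1 = fst p" "fst p2 = fst p"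
        by (simp_all add: p1_def p2_def dir_def)
      then have "(X1 + X2) / 2 = \<phi> (fst p - a) * ((\<phi> (snd p - b + 1) + \<phi> (snd p - b - 1)) / 2)"
        by (simp only: X1_def X2_def distrib_left times_divide_eq_right)
      then show ?thesis
        by (simp only: avg X_def mult.left_commute)
    qed
    have "cos \<theta> ^ Suc d * X = cos \<theta> ^ d * (cos \<theta> * X)"
      by (simp only: power_Suc ac_simps)
    also have "\<dots> = (cos \<theta> ^ d * X1 + cos \<theta> ^ d * X2) / 2"
      by (simp only: avg_product[symmetric] distrib_left times_divide_eq_right)
    also have "\<dots> \<le> (measure_pmf.prob (walk (d + m) (insert p A) p1) {xs. ?Q xs} +
        measure_pmf.prob (walk (d + m) (insert p A) p2) {xs. ?Q xs}) / 2"
      using Suc.IH[of p1 "insert p A"] Suc.IH[of p2 "insert p A"] prems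
      unfolding \<theta>_def X1_def X2_def by (intro divide_right_mono add_mono) auto
    also have "\<dots> = measure_pmf.prob (walk (Suc d + m) A p)
        {xs. \<forall>z\<in>set (take (Suc d) xs). \<bar>fst z - a\<bar> < w \<and> \<bar>snd z - b\<bar> < w}"
      using True unfolding add_Suc prob_walk_Suc p1_def p2_def by simp
    finally show ?thesis
      unfolding \<theta>_def X_def .
  qed
qed

section \<open>Confined blocks at many scales\<close>

lemma exp_le_one_minus: "exp (- 2 * x) \<le> 1 - x" if "0 \<le> x" "x \<le> 1 / 2" for x :: real
proof -
  have "1 \<le> (1 - x) * (1 + 2 * x)"
    using that mult_left_mono[of x "1 / 2" x] by (simp add: algebra_simps)
  also have "\<dots> \<le> (1 - x) * exp (2 * x)"
    using that exp_ge_add_one_self[of "2 * x"] by (intro mult_left_mono) auto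
  finally show ?thesis
    by (simp add: exp_minus field_simps)
qed

text \<open>In a box of half-width \<open>w\<close> of order \<open>sqrt (\<epsilon> * d)\<close>
  the eigenvalue \<open>cos (pi / (2 * w))\<close> is \<open>1 - O(1 / (\<epsilon> * d))\<close>, so
  its \<open>d\<close>-th power has a lower bound that depends on \<epsilon> only.\<close>

lemma prob_few_sites_ge:
  assumes "\<epsilon> > 0" and "\<epsilon> * real d \<ge> 40"
  shows "exp (- 40 / \<epsilon>) \<le> measure_pmf.prob (walk (d + m) A p) {xs. real (card (set (take d xs))) \<le> \<epsilon> * real d}"
proof -
  \<comment> \<open>The box then has at most \<open>4 * w^2 \<le> \<epsilon> * d\<close> sites. As
    the root is at least 6, rounding down keeps \<open>w\<close> above a third of it.\<close>
  define w where "w = \<lfloor>sqrt (\<epsilon> * real d) / 2\<rfloor>"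
  define \<theta> where "\<theta> = pi / (2 * real_of_int w)"
  have d: "d > 0"
    using assms by (cases d) auto
  have sqrt_ge: "sqrt (\<epsilon> * real d) \<ge> 6"
    using assms by (intro real_le_rsqrt) simp
  have w_le: "real_of_int w \<le> sqrt (\<epsilon> * real d) / 2" and w_ge: "real_of_int w \<ge> sqrt (\<epsilon> * real d) / 3"
    using sqrt_ge unfolding w_def by linarith+
  then have w: "w > 0"
    using sqrt_ge by linarith
  have "(2 * real_of_int w)\<^sup>2 \<le> (sqrt (\<epsilon> * real d))\<^sup>2"
    using w w_le by (intro power_mono) auto
  then have box: "4 * (real_of_int w)\<^sup>2 \<le> \<epsilon> * real d"
    using assms by (simp add: power_mult_distrib)
  have "(sqrt (\<epsilon> * real d) / 3)\<^sup>2 \<le> (real_of_int w)\<^sup>2"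
    using w_ge sqrt_ge by (intro power_mono) linarith+
  then have w2: "\<epsilon> * real d \<le> 9 * (real_of_int w)\<^sup>2"
    using assms by (simp add: power_divide)
  have "pi\<^sup>2 \<le> 4\<^sup>2"
    using pi_less_4 pi_gt_zero by (intro power_mono) auto
  then have "\<theta>\<^sup>2 \<le> 4 / (real_of_int w)\<^sup>2"
    using w by (simp add: \<theta>_def power_divide power_mult_distrib field_simps)
  also have "\<dots> \<le> 36 / (\<epsilon> * real d)"
    using w w2 assms d by (simp add: field_simps)
  finally have \<theta>2: "\<theta>\<^sup>2 \<le> 36 / (\<epsilon> * real d)" .
  have cos_ge: "cos \<theta> \<ge> 1 - \<theta>\<^sup>2 / 2"
  proof -
    have "cos \<theta> = 1 - 2 * (sin (\<theta> / 2))\<^sup>2"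
      using cos_double_sin[of "\<theta> / 2"] by simp
    moreover have "(sin (\<theta> / 2))\<^sup>2 \<le> (\<theta> / 2)\<^sup>2"
      using abs_sin_x_le_abs_x[of "\<theta> / 2"] by (simp only: abs_le_square_iff)
    ultimately show ?thesis
      by (simp add: power_divide)
  qed
  \<comment> \<open>The eigenvalue loses at most \<open>18 / (\<epsilon> * d)\<close> per step, and
    \<open>exp_le_one_minus\<close> doubles this to 36; the 40 is a rounding.\<close>
  have "exp (- 40 / \<epsilon>) \<le> exp (- 36 / \<epsilon>)"
    using assms by (simp add: divide_right_mono)
  also have "\<dots> = exp (- 2 * (18 / (\<epsilon> * real d))) ^ d"
    using d by (simp flip: exp_of_nat_mult)
  also have "\<dots> \<le> (1 - 18 / (\<epsilon> * real d)) ^ d"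
    using assms d by (intro power_mono exp_le_one_minus) (auto simp: field_simps)
  also have "\<dots> \<le> cos \<theta> ^ d"
  proof (rule power_mono)
    have "\<theta>\<^sup>2 / 2 \<le> 18 / (\<epsilon> * real d)"
      using \<theta>2 by simp
    then show "1 - 18 / (\<epsilon> * real d) \<le> cos \<theta>"
      using cos_ge by linarith
    show "0 \<le> 1 - 18 / (\<epsilon> * real d)"
      using assms d by (simp add: field_simps)
  qed
  also have "\<dots> \<le> measure_pmf.prob (walk (d + m) A p)
      {xs. \<forall>z\<in>set (take d xs). \<bar>fst z - fst p\<bar> < w \<and> \<bar>snd z - snd p\<bar> < w}"
    using prob_confined_ge[of w p "fst p" "snd p" d m A] w by (simp add: \<theta>_def)
  also have "\<dots> \<le> measure_pmf.prob (walk (d + m) A p) {xs. real (card (set (take d xs))) \<le> \<epsilon> * real d}"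
  proof (rule prob_walk_mono)
    fix xs assume "\<forall>z\<in>set (take d xs). \<bar>fst z - fst p\<bar> < w \<and> \<bar>snd z - snd p\<bar> < w"
    then have "z \<in> {fst p - w<..fst p + w} \<times> {snd p - w<..snd p + w}" if "z \<in> set (take d xs)" for z
      using that by (cases z) (force simp: abs_less_iff)
    then have "set (take d xs) \<subseteq> {fst p - w<..fst p + w} \<times> {snd p - w<..snd p + w}"
      by blast
    then have "card (set (take d xs)) \<le> card ({fst p - w<..fst p + w} \<times> {snd p - w<..snd p + w})"
      by (intro card_mono) auto
    also have "\<dots> = nat (2 * w) * nat (2 * w)"
      by (simp add: card_cartesian_product)
    finally have "real (card (set (take d xs))) \<le> real (nat (2 * w) * nat (2 * w))"
      by (simp only: of_nat_le_iff)
    also have "\<dots> = 4 * (real_of_int w)\<^sup>2"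
      using w by (simp add: power2_eq_square)
    finally show "real (card (set (take d xs))) \<le> \<epsilon> * real d"
      using box by linarith
  qed
  finally show ?thesis .
qed

text \<open>The blocks are consecutive and disjoint, and each one is crowded with probability at
  most \<open>1 - exp (- 40 / \<epsilon>)\<close> whatever the past. The number \<open>m\<close> of
  further steps varies in the induction because the last block belongs to the tail of the shorter
  statement.\<close>

lemma prob_no_good_block_le:
  fixes t :: "nat \<Rightarrow> nat"
  assumes "\<epsilon> > 0" and t0: "t 0 = 0" and mono: "mono t" and "\<And>j. \<epsilon> * real (t (Suc j) - t j) \<ge> 40"
  shows "measure_pmf.prob (walk (t J + m) A p)
      {xs. \<forall>j<J. \<epsilon> * real (t (Suc j) - t j) < real (card (set (take (t (Suc j) - t j) (drop (t j) xs))))}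
      \<le> (1 - exp (- 40 / \<epsilon>)) ^ J"
proof (induction J arbitrary: m)
  case 0
  then show ?case
    by simp
next
  case (Suc J)
  define d where "d = t (Suc J) - t J"
  define B where "B j xs \<longleftrightarrow> \<epsilon> * real (t (Suc j) - t j) < real (card (set (take (t (Suc j) - t j) (drop (t j) xs))))"
    for j and xs :: "(int \<times> int) list"
  let ?Q = "\<lambda>xs :: (int \<times> int) list. \<epsilon> * real d < real (card (set (take d xs)))"
  have eq: "t (Suc J) + m = t J + (d + m)"
    using monoD[OF mono, of J "Suc J"] by (simp add: d_def)
  have local_B: "B j (take (t J) xs) = B j xs" if "j < J" for j xs
    using monoD[OF mono, of "Suc j" J] that by (simp add: B_def drop_take min_def diff_le_mono)
  have "B J xs \<longleftrightarrow> ?Q (drop (t J) xs)" for xs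
    by (simp add: B_def d_def)
  then have iff: "{xs. \<forall>j<Suc J. B j xs} = {xs. (\<forall>j<J. B j (take (t J) xs)) \<and> ?Q (drop (t J) xs)}"
    by (auto simp: local_B less_Suc_eq)
  have "measure_pmf.prob (walk (d + m) A p) {xs. ?Q xs} \<le> 1 - exp (- 40 / \<epsilon>)" for A p
  proof -
    have "measure_pmf.prob (walk (d + m) A p) {xs. ?Q xs} =
        1 - measure_pmf.prob (walk (d + m) A p) {xs. real (card (set (take d xs))) \<le> \<epsilon> * real d}"
      by (subst measure_pmf.prob_compl[symmetric]) (auto intro!: arg_cong2[where f = measure])
    then show ?thesis
      using prob_few_sites_ge[OF assms(1), of d m A p] assms(4)[of J] unfolding d_def[symmetric] by linarith
  qed
  then have "measure_pmf.prob (walk (t J + (d + m)) A p) {xs. (\<forall>j<J. B j (take (t J) xs)) \<and> ?Q (drop (t J) xs)}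
      \<le> (1 - exp (- 40 / \<epsilon>)) * measure_pmf.prob (walk (t J + (d + m)) A p) {xs. \<forall>j<J. B j (take (t J) xs)}"
    by (rule prob_walk_take_drop_le)
  also have "\<dots> \<le> (1 - exp (- 40 / \<epsilon>)) * (1 - exp (- 40 / \<epsilon>)) ^ J"
    using Suc.IH[of "d + m"] assms(1) by (intro mult_left_mono) (simp_all add: local_B B_def[symmetric])
  finally show ?case
    unfolding eq B_def[symmetric] iff power_Suc .
qed

text \<open>Greedy covering of the trajectory by windows that contain few sites.\<close>

lemma card_set_le_windows:
  fixes t :: "nat \<Rightarrow> nat" and xs :: "'a list" and \<delta> :: real and J :: nat
  defines "bad \<equiv> \<lambda>s. \<forall>j<J. \<delta> * real (t (Suc j)) < real (card (set (take (t (Suc j)) (drop s xs))))"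
  assumes "\<delta> \<ge> 0" and mono: "mono t" and pos: "\<And>j. t (Suc j) > 0"
  shows "real (card (set (drop s xs))) \<le> \<delta> * real (length xs - s)
     + real (card {i. s \<le> i \<and> i + t J < length xs \<and> bad i}) + real (t J)"
proof (induction "length xs - s" arbitrary: s rule: less_induct)
  case less
  let ?bad = "\<lambda>s. {i. s \<le> i \<and> i + t J < length xs \<and> bad i}"
  have fin: "finite (?bad s)" for s
    by (rule finite_subset[of _ "{..<length xs}"]) auto
  show ?case
  proof (cases "s + t J < length xs")
    case False
    then have "card (set (drop s xs)) \<le> t J"
      using card_length[of "drop s xs"] by simp
    then show ?thesis
      using \<open>\<delta> \<ge> 0\<close> by (simp add: add_increasing)
  next
    case True
    \<comment> \<open>From a bad time advance by one: this costs at most one site, paid by the count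
      of bad times. From any other time jump over a window that costs \<delta> per step.\<close>
    show ?thesis
    proof (cases "bad s")
      case bad: True
      have "drop s xs = xs ! s # drop (Suc s) xs"
        using True by (simp add: Cons_nth_drop_Suc)
      then have "card (set (drop s xs)) \<le> Suc (card (set (drop (Suc s) xs)))"
        by (simp add: card_insert_if)
      moreover have "?bad s = insert s (?bad (Suc s))"
        using True bad by (auto simp: Suc_le_eq order.order_iff_strict)
      then have "card (?bad s) = Suc (card (?bad (Suc s)))"
        using fin by simp
      moreover have "\<delta> * real (length xs - Suc s) \<le> \<delta> * real (length xs - s)"
        using \<open>\<delta> \<ge> 0\<close> by (intro mult_left_mono) auto
      ultimately show ?thesis
        using less[of "Suc s"] True by linarith
    next
      case False
      then obtain j where j: "j < J" and good: "real (card (set (take (t (Suc j)) (drop s xs)))) \<le> \<delta> * real (t (Suc j))"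
        by (auto simp: bad_def not_less)
      define T where "T = t (Suc j)"
      have T: "0 < T" "T \<le> t J"
        using pos[of j] monoD[OF mono, of "Suc j" J] j by (auto simp: T_def)
      have "set (drop s xs) = set (take T (drop s xs)) \<union> set (drop (s + T) xs)"
        by (metis add.commute append_take_drop_id drop_drop set_append)
      then have "card (set (drop s xs)) \<le> card (set (take T (drop s xs))) + card (set (drop (s + T) xs))"
        by (simp add: card_Un_le)
      moreover have "card (?bad (s + T)) \<le> card (?bad s)"
        by (rule card_mono[OF fin]) auto
      moreover have "real (card (set (drop (s + T) xs))) \<le> \<delta> * real (length xs - (s + T))
          + real (card (?bad (s + T))) + real (t J)"
        using less[of "s + T"] True T by simp
      moreover have "\<delta> * real (length xs - s) = \<delta> * real T + \<delta> * real (length xs - (s + T))"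
        using True T by (simp add: of_nat_diff algebra_simps)
      ultimately show ?thesis
        using good unfolding T_def by linarith
    qed
  qed
qed

text \<open>Markov's inequality for the number of events that occur; dependence between the events
  does no harm.\<close>

lemma prob_count_ge_le:
  assumes "finite S" and "c > 0" and "\<And>s. s \<in> S \<Longrightarrow> measure_pmf.prob p {x. B s x} \<le> r"
  shows "measure_pmf.prob p {x. c \<le> real (card {s \<in> S. B s x})} \<le> real (card S) * r / c"
proof -
  have int: "integrable (measure_pmf p) (indicat_real X)" for X
    by (rule measure_pmf.integrable_const_bound[where B = 1]) auto
  have "c * measure_pmf.prob p {x. c \<le> real (card {s \<in> S. B s x})} =
      measure_pmf.expectation p (\<lambda>x. c * indicator {x. c \<le> real (card {s \<in> S. B s x})} x)"
    by simp
  also have "\<dots> \<le> measure_pmf.expectation p (\<lambda>x. \<Sum>s\<in>S. indicator {x. B s x} x)"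
  proof (rule integral_mono)
    fix x
    have "(\<Sum>s\<in>S. indicator {x. B s x} x) = real (card {s \<in> S. B s x})"
      using assms(1) by (simp add: indicator_def sum.If_cases Int_def)
    then show "c * indicator {x. c \<le> real (card {s \<in> S. B s x})} x \<le> (\<Sum>s\<in>S. indicator {x. B s x} x)"
      by (simp add: indicator_def)
  next
    show "integrable (measure_pmf p) (\<lambda>x. c * indicator {x. c \<le> real (card {s \<in> S. B s x})} x)"
      by (intro integrable_mult_right int)
    show "integrable (measure_pmf p) (\<lambda>x. \<Sum>s\<in>S. indicat_real {x. B s x} x)"
      by (intro Bochner_Integration.integrable_sum int)
  qed
  also have "\<dots> = (\<Sum>s\<in>S. measure_pmf.prob p {x. B s x})"
    by (subst Bochner_Integration.integral_sum) (rule int, simp)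
  also have "\<dots> \<le> real (card S) * r"
    using assms(3) by (rule sum_bounded_above)
  finally show ?thesis
    using assms(2) by (simp add: field_simps)
qed

text \<open>Windows have lengths \<open>K ^ j\<close>. As \<open>K \<ge> 41 / \<epsilon>\<close>,
  the earlier scales fill at most a fraction \<epsilon> of a window, so a confined block yields a
  window with at most \<open>2 * \<epsilon>\<close> sites per step. The 41 leaves the 40 required of
  a block after the earlier scale is removed.\<close>

lemma prob_many_sites_le:
  assumes "0 < \<epsilon>" "\<epsilon> \<le> 1" and "real K \<ge> 41 / \<epsilon>" and "c > 0"
  shows "measure_pmf.prob (walk n {} (0, 0))
      {xs. 2 * \<epsilon> * real (Suc n) + real (K ^ J) + c \<le> real (card (set xs))}
      \<le> real (Suc n) * (1 - exp (- 40 / \<epsilon>)) ^ J / c"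
proof -
  \<comment> \<open>With \<open>t 0 = 0\<close> instead of 1 the first block begins where the window
    does.\<close>
  define t where "t j = (if j = 0 then 0 else K ^ j)" for j
  define bad where "bad s xs \<longleftrightarrow> (\<forall>j<J. 2 * \<epsilon> * real (t (Suc j)) < real (card (set (take (t (Suc j)) (drop s xs)))))"
    for s and xs :: "(int \<times> int) list"
  have "41 \<le> 41 / \<epsilon>"
    using assms(1,2) by (simp add: field_simps)
  then have K: "K \<ge> 41"
    using assms(3) by linarith
  have mono: "mono t"
    using K by (auto simp: mono_def t_def intro: power_increasing)
  have \<epsilon>K: "\<epsilon> * real K \<ge> 41"
    using assms(1,3) by (simp add: field_simps)
  have step: "real (t j) \<le> \<epsilon> * real (t (Suc j))" for j
  proof (cases "j = 0")
    case False
    have "1 * real (K ^ j) \<le> (\<epsilon> * real K) * real (K ^ j)"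
      using \<epsilon>K by (intro mult_right_mono) auto
    then show ?thesis
      using False by (simp add: t_def algebra_simps)
  qed (use assms in \<open>simp add: t_def\<close>)
  have gap: "\<epsilon> * real (t (Suc j) - t j) \<ge> 40" for j
  proof (cases "j = 0")
    case True
    then show ?thesis
      using \<epsilon>K by (simp add: t_def)
  next
    case False
    have "40 * 1 \<le> (\<epsilon> * real K - \<epsilon>) * real (K ^ j)"
      using \<epsilon>K assms(2) K by (intro mult_mono) (auto simp flip: of_nat_power)
    also have "\<dots> = \<epsilon> * real (t (Suc j) - t j)"
      using False K by (simp add: t_def of_nat_diff algebra_simps)
    finally show ?thesis
      by (simp only: mult_1_right)
  qed
  have bad_block: "\<epsilon> * real (t (Suc j) - t j) < real (card (set (take (t (Suc j) - t j) (drop (t j) xs))))"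
    if "2 * \<epsilon> * real (t (Suc j)) < real (card (set (take (t (Suc j)) xs)))" for j and xs :: "(int \<times> int) list"
  proof -
    have "t j \<le> t (Suc j)"
      using monoD[OF mono, of j "Suc j"] by simp
    then have "take (t (Suc j)) xs = take (t j) xs @ take (t (Suc j) - t j) (drop (t j) xs)"
      by (metis le_add_diff_inverse take_add)
    then have "card (set (take (t (Suc j)) xs)) \<le>
        card (set (take (t j) xs)) + card (set (take (t (Suc j) - t j) (drop (t j) xs)))"
      by (simp add: card_Un_le)
    moreover have "card (set (take (t j) xs)) \<le> t j"
      using card_length[of "take (t j) xs"] by simp
    moreover have "\<epsilon> * real (t (Suc j) - t j) \<le> \<epsilon> * real (t (Suc j))"
      using assms(1) by (intro mult_left_mono) auto
    ultimately show ?thesis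
      using that step[of j] by linarith
  qed
  have bad_prob: "measure_pmf.prob (walk n {} (0, 0)) {xs. bad s xs} \<le> (1 - exp (- 40 / \<epsilon>)) ^ J"
    if "s \<in> {s. s + t J < Suc n}" for s
  proof -
    define m where "m = n - (s + t J)"
    have n: "n = s + (t J + m)"
      using that by (simp add: m_def)
    have "measure_pmf.prob (walk (t J + m) A p) {xs. bad 0 xs} \<le> (1 - exp (- 40 / \<epsilon>)) ^ J" for A p
    proof -
      have "measure_pmf.prob (walk (t J + m) A p) {xs. bad 0 xs} \<le> measure_pmf.prob (walk (t J + m) A p)
        {xs. \<forall>j<J. \<epsilon> * real (t (Suc j) - t j) < real (card (set (take (t (Suc j) - t j) (drop (t j) xs))))}"
        using bad_block by (intro prob_walk_mono) (auto simp: bad_def)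
      also have "\<dots> \<le> (1 - exp (- 40 / \<epsilon>)) ^ J"
        by (rule prob_no_good_block_le[OF assms(1) _ mono gap]) (simp add: t_def)
      finally show ?thesis .
    qed
    then have "measure_pmf.prob (walk (s + (t J + m)) {} (0, 0)) {xs. bad 0 (drop s xs)} \<le> (1 - exp (- 40 / \<epsilon>)) ^ J"
      by (rule prob_walk_drop_le)
    then show ?thesis
      by (simp add: n bad_def)
  qed
  have "measure_pmf.prob (walk n {} (0, 0)) {xs. 2 * \<epsilon> * real (Suc n) + real (K ^ J) + c \<le> real (card (set xs))}
     \<le> measure_pmf.prob (walk n {} (0, 0)) {xs. c \<le> real (card {s \<in> {s. s + t J < Suc n}. bad s xs})}"
  proof (rule prob_walk_mono)
    fix xs :: "(int \<times> int) list" assume len: "length xs = Suc n"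
      and *: "2 * \<epsilon> * real (Suc n) + real (K ^ J) + c \<le> real (card (set xs))"
    have "real (card (set (drop 0 xs))) \<le> 2 * \<epsilon> * real (length xs - 0)
       + real (card {i. 0 \<le> i \<and> i + t J < length xs \<and> bad i xs}) + real (t J)"
      unfolding bad_def by (rule card_set_le_windows[OF _ mono]) (use assms(1) K in \<open>simp_all add: t_def\<close>)
    moreover have "real (t J) \<le> real (K ^ J)"
      by (simp add: t_def)
    ultimately show "c \<le> real (card {s \<in> {s. s + t J < Suc n}. bad s xs})"
      using * unfolding len by (simp only: mem_Collect_eq drop_0 diff_zero le0 simp_thms)
  qed
  also have "\<dots> \<le> real (card {s. s + t J < Suc n}) * (1 - exp (- 40 / \<epsilon>)) ^ J / c"
    using assms(4) bad_prob by (intro prob_count_ge_le) (auto intro: finite_subset[of _ "{..<Suc n}"])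
  also have "\<dots> \<le> real (Suc n) * (1 - exp (- 40 / \<epsilon>)) ^ J / c"
  proof -
    have "card {s. s + t J < Suc n} \<le> card {..<Suc n}"
      by (intro card_mono) auto
    then show ?thesis
      using assms(1,4) by (intro divide_right_mono mult_right_mono) auto
  qed
  finally show ?thesis .
qed

text \<open>Take \<epsilon> = 1 / u with \<open>u = sqrt (ln (ln n))\<close>. About
  \<open>ln n / (2 * ln K)\<close> scales fit below \<open>sqrt n\<close>, where \<open>K\<close> is
  of order \<open>u\<close>. As \<open>ln n = exp (u^2)\<close> outgrows
  \<open>exp (40 * u)\<close>, most times see a confined block.\<close>

lemma prob_many_sites_tendsto_0:
  "(\<lambda>n. measure_pmf.prob (walk n {} (0, 0)) {xs. 8 * real n / sqrt (ln (ln (real n))) \<le> real (card (set xs))}) \<longlonglongrightarrow> 0"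
proof (rule tendsto_sandwich[where f = "\<lambda>_. 0"])
  let ?u = "\<lambda>n. sqrt (ln (ln (real n)))"
  \<comment> \<open>The factor \<open>2 * u\<close> bounds \<open>(n + 1) / c\<close>, the
    denominator \<open>84 * u\<close> bounds \<open>2 * ln K\<close>, and the 1 in the exponent
    absorbs the rounding of \<open>J\<close>.\<close>
  let ?f = "\<lambda>u::real. 2 * u * exp (1 - exp (u^2 - 40 * u) / (84 * u))"
  have u: "filterlim ?u at_top sequentially"
    by real_asymp
  have f: "(?f \<longlongrightarrow> 0) at_top"
    by real_asymp
  show "(\<lambda>n. ?f (?u n)) \<longlonglongrightarrow> 0"
    using filterlim_compose[OF f u] .
  have ev: "eventually (\<lambda>n. 2 * (1 / ?u n) * (real n + 1) + sqrt (real n) + real n / ?u n \<le> 8 * real n / ?u n) sequentially"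
    by real_asymp
  show "eventually (\<lambda>n. measure_pmf.prob (walk n {} (0, 0)) {xs. 8 * real n / ?u n \<le> real (card (set xs))} \<le> ?f (?u n)) sequentially"
    using ev eventually_gt_at_top[of 1] filterlim_at_top_dense[THEN iffD1, OF u, rule_format, of 1]
  proof eventually_elim
    case (elim n)
    define u where "u = ?u n"
    define K where "K = nat \<lceil>41 * u\<rceil>"
    define J where "J = nat \<lfloor>ln (real n) / (2 * ln (real K))\<rfloor>"
    define c where "c = real n / u"
    define q where "q = exp (- 40 * u)"
    have u: "u > 1"
      using elim by (simp add: u_def)
    have ln_n: "ln (real n) = exp (u\<^sup>2)"
    proof -
      have "0 < ln (real n)"
        using elim(2) by simp
      moreover have "0 \<le> ln (ln (real n))"
        using u unfolding u_def by (smt (verit) real_sqrt_lt_0_iff)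
      ultimately show ?thesis
        by (simp add: u_def)
    qed
    have K: "real K \<ge> 41 * u" "real K \<le> 42 * u"
      using u unfolding K_def by linarith+
    have ln_K: "ln (real K) > 0" "ln (real K) \<le> 42 * u"
      using K u ln_le_minus_one[of "real K"] by auto
    have "0 \<le> ln (real n) / (2 * ln (real K))"
      using ln_K(1) elim(2) by simp
    then have J: "real J \<le> ln (real n) / (2 * ln (real K))" "real J \<ge> ln (real n) / (2 * ln (real K)) - 1"
      unfolding J_def by linarith+
    have KJ: "real (K ^ J) \<le> sqrt (real n)"
    proof -
      have "ln (real (K ^ J)) = real J * ln (real K)"
        using K u by (simp add: ln_realpow)
      also have "\<dots> \<le> ln (real n) / (2 * ln (real K)) * ln (real K)"
        using J(1) ln_K(1) by (intro mult_right_mono) auto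
      also have "\<dots> = ln (sqrt (real n))"
        using ln_K(1) elim by (simp add: ln_sqrt)
      finally show ?thesis
        using K u elim by (subst (asm) ln_le_cancel_iff) auto
    qed
    have q: "0 < q" "q < 1"
      using u by (auto simp: q_def)
    have "exp (u\<^sup>2 - 40 * u) / (84 * u) - 1 \<le> q * (exp (u\<^sup>2) / (84 * u)) - q * 1"
      using q by (simp add: q_def exp_diff exp_minus field_simps)
    also have "\<dots> \<le> q * (exp (u\<^sup>2) / (2 * ln (real K))) - q * 1"
      using q ln_K u by (intro diff_right_mono mult_left_mono divide_left_mono) auto
    also have "\<dots> \<le> q * real J"
      using J(2) q unfolding ln_n right_diff_distrib[symmetric] by (intro mult_left_mono) auto
    finally have qJ: "exp (u\<^sup>2 - 40 * u) / (84 * u) - 1 \<le> q * real J" .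
    have "measure_pmf.prob (walk n {} (0, 0)) {xs. 8 * real n / u \<le> real (card (set xs))}
       \<le> measure_pmf.prob (walk n {} (0, 0)) {xs. 2 * (1 / u) * real (Suc n) + real (K ^ J) + c \<le> real (card (set xs))}"
    proof (rule prob_walk_mono)
      fix xs :: "(int \<times> int) list"
      assume "8 * real n / u \<le> real (card (set xs))"
      then show "2 * (1 / u) * real (Suc n) + real (K ^ J) + c \<le> real (card (set xs))"
        using elim(1) KJ unfolding u_def[symmetric] c_def of_nat_Suc by (smt (verit))
    qed
    also have "\<dots> \<le> real (Suc n) * (1 - exp (- 40 / (1 / u))) ^ J / c"
      using u K elim by (intro prob_many_sites_le) (auto simp: c_def)
    also have "\<dots> = real (Suc n) / real n * u * (1 - q) ^ J"
      using u by (simp add: c_def q_def)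
    also have "\<dots> \<le> 2 * u * exp (- q) ^ J"
      using q u elim exp_ge_add_one_self[of "- q"] by (intro mult_mono power_mono) (auto simp: field_simps)
    also have "\<dots> \<le> 2 * u * exp (1 - exp (u\<^sup>2 - 40 * u) / (84 * u))"
      using qJ u by (simp add: mult.commute flip: exp_of_nat_mult)
    finally show ?case
      unfolding u_def .
  qed
qed (auto intro!: always_eventually)

section \<open>Exit from an interval\<close>

text \<open>Gambler's ruin: the probability that simple random walk from \<open>x\<close> leaves
  through \<beta>. For \<alpha> = \<beta> division by zero makes it 0, and \<open>exit_mean\<close>
  is the value at the single end point.\<close>

definition exit_prob :: "int \<Rightarrow> int \<Rightarrow> int \<Rightarrow> real" where
  "exit_prob \<alpha> \<beta> x = (real_of_int x - real_of_int \<alpha>) / (real_of_int \<beta> - real_of_int \<alpha>)"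

definition exit_mean :: "int \<Rightarrow> int \<Rightarrow> int \<Rightarrow> (int \<Rightarrow> real) \<Rightarrow> real" where
  "exit_mean \<alpha> \<beta> x F = (1 - exit_prob \<alpha> \<beta> x) * F \<alpha> + exit_prob \<alpha> \<beta> x * F \<beta>"

text \<open>The distance to \<open>c\<close> grows by one in mean at each visit to \<open>c\<close>
  and is a martingale otherwise. Hence this is the Green function, the mean number of visits to
  \<open>c\<close> before the exit, expressed without paths.\<close>

definition green :: "int \<Rightarrow> int \<Rightarrow> int \<Rightarrow> int \<Rightarrow> real" where
  "green \<alpha> \<beta> x c = exit_mean \<alpha> \<beta> x (\<lambda>k. real_of_int \<bar>k - c\<bar>) - real_of_int \<bar>x - c\<bar>"

definition laplace :: "(int \<Rightarrow> real) \<Rightarrow> int \<Rightarrow> real" where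
  "laplace F c = F (c + 1) + F (c - 1) - 2 * F c"

lemma exit_prob_bounds:
  assumes "\<alpha> \<le> x" "x \<le> \<beta>"
  shows "0 \<le> exit_prob \<alpha> \<beta> x" "exit_prob \<alpha> \<beta> x \<le> 1"
  using assms by (auto simp: exit_prob_def divide_le_eq)

lemma exit_prob_mult:
  assumes "\<alpha> \<le> x" "x \<le> \<beta>"
  shows "exit_prob \<alpha> \<beta> x * (real_of_int \<beta> - real_of_int \<alpha>) = real_of_int x - real_of_int \<alpha>"
  using assms by (auto simp: exit_prob_def)

lemma exit_mean_add: "exit_mean \<alpha> \<beta> x (\<lambda>k. F k + G k) = exit_mean \<alpha> \<beta> x F + exit_mean \<alpha> \<beta> x G"
  by (simp add: exit_mean_def algebra_simps)

lemma exit_mean_diff: "exit_mean \<alpha> \<beta> x (\<lambda>k. F k - G k) = exit_mean \<alpha> \<beta> x F - exit_mean \<alpha> \<beta> x G"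
  by (simp add: exit_mean_def algebra_simps)

lemma exit_mean_const [simp]: "exit_mean \<alpha> \<beta> x (\<lambda>_. c) = c"
  by (simp add: exit_mean_def algebra_simps)

lemma exit_mean_mult: "exit_mean \<alpha> \<beta> x (\<lambda>k. c * F k) = c * exit_mean \<alpha> \<beta> x F"
  by (simp add: exit_mean_def algebra_simps)

lemma exit_mean_sum: "exit_mean \<alpha> \<beta> x (\<lambda>k. \<Sum>i\<in>I. F i k) = (\<Sum>i\<in>I. exit_mean \<alpha> \<beta> x (F i))"
  by (simp add: exit_mean_def sum_distrib_left sum.distrib)

lemma exit_mean_mono:
  assumes "\<alpha> \<le> x" "x \<le> \<beta>" "F \<alpha> \<le> G \<alpha>" "F \<beta> \<le> G \<beta>"
  shows "exit_mean \<alpha> \<beta> x F \<le> exit_mean \<alpha> \<beta> x G"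
  unfolding exit_mean_def using assms exit_prob_bounds[OF assms(1,2)]
  by (intro add_mono mult_left_mono) auto

lemma exit_mean_id:
  assumes "\<alpha> \<le> x" "x \<le> \<beta>"
  shows "exit_mean \<alpha> \<beta> x real_of_int = real_of_int x"
  using exit_prob_mult[OF assms] by (simp add: exit_mean_def algebra_simps)

text \<open>The second summand on the right is the variance of the exit point, and also the mean
  exit time.\<close>

lemma exit_mean_square:
  assumes "\<alpha> \<le> x" "x \<le> \<beta>"
  shows "exit_mean \<alpha> \<beta> x (\<lambda>k. (real_of_int k - z)\<^sup>2) =
    (real_of_int x - z)\<^sup>2 + (real_of_int x - real_of_int \<alpha>) * (real_of_int \<beta> - real_of_int x)"
proof -
  define p a b y where "p = exit_prob \<alpha> \<beta> x" and "a = real_of_int \<alpha>" and "b = real_of_int \<beta>" and "y = real_of_int x"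
  have p: "p * (b - a) = y - a"
    using exit_prob_mult[OF assms] by (simp add: p_def a_def b_def y_def)
  have "(1 - p) * (a - z)\<^sup>2 + p * (b - z)\<^sup>2 = (a - z)\<^sup>2 + p * (b - a) * (a + b - 2 * z)"
    by (simp add: power2_eq_square algebra_simps)
  also have "\<dots> = (y - z)\<^sup>2 + (y - a) * (b - y)"
    unfolding p by (simp add: power2_eq_square algebra_simps)
  finally show ?thesis
    by (simp add: exit_mean_def p_def a_def b_def y_def)
qed

lemma green_nonneg:
  assumes "\<alpha> \<le> x" "x \<le> \<beta>"
  shows "0 \<le> green \<alpha> \<beta> x c"
proof -
  have "exit_mean \<alpha> \<beta> x (\<lambda>k. real_of_int k - real_of_int c) \<le> exit_mean \<alpha> \<beta> x (\<lambda>k. real_of_int \<bar>k - c\<bar>)"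
    by (rule exit_mean_mono[OF assms]) auto
  moreover have "exit_mean \<alpha> \<beta> x (\<lambda>k. real_of_int c - real_of_int k) \<le> exit_mean \<alpha> \<beta> x (\<lambda>k. real_of_int \<bar>k - c\<bar>)"
    by (rule exit_mean_mono[OF assms]) auto
  ultimately show ?thesis
    unfolding green_def exit_mean_diff exit_mean_id[OF assms] by simp
qed

text \<open>Seen from such a \<open>c\<close> the distance is affine on the interval, and
  \<open>exit_mean\<close> preserves affine functions.\<close>

lemma green_eq_0:
  assumes "\<alpha> \<le> x" "x \<le> \<beta>" and "c \<le> \<alpha> \<or> \<beta> \<le> c"
  shows "green \<alpha> \<beta> x c = 0"
  using assms(3)
proof
  assume "c \<le> \<alpha>"
  then have "exit_mean \<alpha> \<beta> x (\<lambda>k. real_of_int \<bar>k - c\<bar>) = exit_mean \<alpha> \<beta> x (\<lambda>k. real_of_int k - real_of_int c)"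
    using assms(1,2) by (simp add: exit_mean_def)
  then show ?thesis
    using \<open>c \<le> \<alpha>\<close> assms(1) unfolding green_def exit_mean_diff exit_mean_id[OF assms(1,2)] by simp
next
  assume "\<beta> \<le> c"
  then have "exit_mean \<alpha> \<beta> x (\<lambda>k. real_of_int \<bar>k - c\<bar>) = exit_mean \<alpha> \<beta> x (\<lambda>k. real_of_int c - real_of_int k)"
    using assms(1,2) by (simp add: exit_mean_def)
  then show ?thesis
    using \<open>\<beta> \<le> c\<close> assms(2) unfolding green_def exit_mean_diff exit_mean_id[OF assms(1,2)] by simp
qed

lemma laplace_abs: "laplace (\<lambda>c. real_of_int \<bar>k - c\<bar>) c = 2 * of_bool (k = c)"
  by (cases "k < c"; cases "k = c") (auto simp: laplace_def abs_if)

lemma laplace_green: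
  "laplace (green \<alpha> \<beta> x) c =
     2 * exit_mean \<alpha> \<beta> x (\<lambda>k. of_bool (k = c)) - 2 * of_bool (x = c)"
proof -
  have "laplace (green \<alpha> \<beta> x) c = (1 - exit_prob \<alpha> \<beta> x) * laplace (\<lambda>c. real_of_int \<bar>\<alpha> - c\<bar>) c
      + exit_prob \<alpha> \<beta> x * laplace (\<lambda>c. real_of_int \<bar>\<beta> - c\<bar>) c - laplace (\<lambda>c. real_of_int \<bar>x - c\<bar>) c"
    unfolding laplace_def green_def exit_mean_def by (simp only: algebra_simps)
  then show ?thesis
    unfolding laplace_abs exit_mean_def by (simp only: algebra_simps)
qed

section \<open>Summation by parts and Dirichlet energy\<close>

lemma sum_shift:
  fixes f :: "int \<Rightarrow> real"
  assumes "\<And>c. \<bar>c\<bar> \<ge> B \<Longrightarrow> f c = 0" and "\<bar>d\<bar> \<le> 1"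
  shows "(\<Sum>c\<in>{-B..B}. f (c + d)) = (\<Sum>c\<in>{-B..B}. f c)"
proof -
  have "(\<Sum>c\<in>{-B..B}. f (c + d)) = (\<Sum>c\<in>{-B+d..B+d}. f c)"
    by (rule sum.reindex_bij_witness[of _ "\<lambda>c. c - d" "\<lambda>c. c + d"]) auto
  also have "\<dots> = (\<Sum>c\<in>{-B+1..B-1}. f c)"
    using assms(2) by (intro sum.mono_neutral_right ballI assms(1)) auto
  also have "\<dots> = (\<Sum>c\<in>{-B..B}. f c)"
    by (intro sum.mono_neutral_left ballI assms(1)) auto
  finally show ?thesis .
qed

lemma laplace_by_parts:
  assumes "\<And>c. \<bar>c\<bar> \<ge> B \<Longrightarrow> a c = 0"
  shows "(\<Sum>c\<in>{-B..B}. a c * laplace F c) = (\<Sum>c\<in>{-B..B}. laplace a c * F c)" (is ?A)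
    and "(\<Sum>c\<in>{-B..B}. a c * laplace a c) = - (\<Sum>c\<in>{-B..B}. (a (c + 1) - a c)\<^sup>2)" (is ?B)
proof -
  have right: "(\<Sum>c\<in>{-B..B}. a (c + 1) * F c) = (\<Sum>c\<in>{-B..B}. a c * F (c - 1))" for F
    using sum_shift[of B "\<lambda>c. a c * F (c - 1)" 1] assms by simp
  have left: "(\<Sum>c\<in>{-B..B}. a (c - 1) * F c) = (\<Sum>c\<in>{-B..B}. a c * F (c + 1))" for F
    using sum_shift[of B "\<lambda>c. a c * F (c + 1)" "-1"] assms by simp
  show ?A
    unfolding laplace_def distrib_left distrib_right left_diff_distrib right_diff_distrib sum.distrib sum_subtractf
      left right by (simp add: algebra_simps)
  have sq: "(\<Sum>c\<in>{-B..B}. a (c + 1) * a (c + 1)) = (\<Sum>c\<in>{-B..B}. a c * a c)"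
    using sum_shift[of B "\<lambda>c. a c * a c" 1] assms by simp
  have "(\<Sum>c\<in>{-B..B}. (a (c + 1) - a c)\<^sup>2) =
      (\<Sum>c\<in>{-B..B}. a (c + 1) * a (c + 1)) + (\<Sum>c\<in>{-B..B}. a c * a c) - 2 * (\<Sum>c\<in>{-B..B}. a c * a (c + 1))"
    by (simp add: power2_eq_square algebra_simps sum.distrib sum_subtractf sum_distrib_left)
  moreover have "(\<Sum>c\<in>{-B..B}. a c * laplace a c) =
      (\<Sum>c\<in>{-B..B}. a c * a (c + 1)) + (\<Sum>c\<in>{-B..B}. a c * a (c - 1)) - 2 * (\<Sum>c\<in>{-B..B}. a c * a c)"
    by (simp add: laplace_def algebra_simps sum.distrib sum_subtractf sum_distrib_left)
  moreover have "(\<Sum>c\<in>{-B..B}. a c * a (c - 1)) = (\<Sum>c\<in>{-B..B}. a c * a (c + 1))"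
    using right[of a] by (simp add: mult.commute)
  ultimately show ?B
    unfolding sq by simp
qed

text \<open>Dynkin's formula. The Laplacian is moved onto the Green function, where it leaves only
  point masses at the two end points and at \<open>x\<close>.\<close>

lemma green_identity:
  assumes "\<alpha> \<le> x" "x \<le> \<beta>" and "- B \<le> \<alpha>" "\<beta> \<le> B"
  shows "exit_mean \<alpha> \<beta> x F - F x = (\<Sum>c\<in>{-B..B}. green \<alpha> \<beta> x c * laplace F c) / 2"
proof -
  have point: "(\<Sum>c\<in>{-B..B}. of_bool (k = c) * F c) = F k" if "\<alpha> \<le> k" "k \<le> \<beta>" for k
  proof -
    have "(\<Sum>c\<in>{-B..B}. of_bool (k = c) * F c) = (\<Sum>c\<in>{k}. F c)"
      using that assms by (intro sum.mono_neutral_cong_right) auto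
    then show ?thesis
      by simp
  qed
  have "(\<Sum>c\<in>{-B..B}. green \<alpha> \<beta> x c * laplace F c) = (\<Sum>c\<in>{-B..B}. laplace (green \<alpha> \<beta> x) c * F c)"
    using assms by (intro laplace_by_parts(1) green_eq_0) auto
  also have "\<dots> = 2 * ((1 - exit_prob \<alpha> \<beta> x) * (\<Sum>c\<in>{-B..B}. of_bool (\<alpha> = c) * F c)
     + exit_prob \<alpha> \<beta> x * (\<Sum>c\<in>{-B..B}. of_bool (\<beta> = c) * F c)) - 2 * (\<Sum>c\<in>{-B..B}. of_bool (x = c) * F c)"
    unfolding laplace_green exit_mean_def sum_distrib_left sum_subtractf[symmetric] sum.distrib[symmetric]
    by (intro sum.cong refl) (simp only: algebra_simps)
  also have "\<dots> = 2 * (exit_mean \<alpha> \<beta> x F - F x)"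
    using assms by (simp add: point exit_mean_def)
  finally show ?thesis
    by simp
qed

text \<open>Among \<open>card S + 1\<close> consecutive sites from \<open>c\<close> on, one lies
  outside \<open>S\<close>, where \<open>G\<close> vanishes. Telescope up to it and apply
  Cauchy-Schwarz. The set \<open>S\<close> may be scattered; only its size enters.\<close>

lemma square_le_energy:
  fixes G :: "int \<Rightarrow> real"
  assumes "finite S" and supp: "\<And>c. c \<notin> S \<Longrightarrow> G c = 0" and B: "\<And>c. \<bar>c\<bar> \<ge> B \<Longrightarrow> G c = 0"
  shows "(G c)\<^sup>2 \<le> real (card S) * (\<Sum>k\<in>{-B..B}. (G (k + 1) - G k)\<^sup>2)"
proof -
  let ?d = "\<lambda>k. G (k + 1) - G k"
  have "\<not> (\<lambda>i. c + int i) ` {..card S} \<subseteq> S"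
  proof
    assume "(\<lambda>i. c + int i) ` {..card S} \<subseteq> S"
    then have "card ((\<lambda>i. c + int i) ` {..card S}) \<le> card S"
      by (rule card_mono[OF assms(1)])
    moreover have "card ((\<lambda>i. c + int i) ` {..card S}) = Suc (card S)"
      by (subst card_image) (auto simp: inj_on_def)
    ultimately show False
      by simp
  qed
  then obtain t where t: "t \<le> card S" "c + int t \<notin> S"
    by auto
  have "(\<Sum>i<t. ?d (c + int i)) = G (c + int t) - G c"
    using sum_lessThan_telescope[of "\<lambda>i. G (c + int i)" t] by (simp add: algebra_simps)
  then have "(G c)\<^sup>2 = (\<Sum>i<t. ?d (c + int i))\<^sup>2"
    using supp[OF t(2)] by simp
  also have "\<dots> \<le> (\<Sum>i<t. (?d (c + int i))\<^sup>2) * real (card {..<t})"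
    by (rule sum_squared_le_sum_of_squares)
  also have "\<dots> \<le> (\<Sum>k\<in>{-B..B}. (?d k)\<^sup>2) * real (card S)"
  proof (rule mult_mono)
    have "(\<Sum>i<t. (?d (c + int i))\<^sup>2) = (\<Sum>k\<in>(\<lambda>i. c + int i) ` {..<t}. (?d k)\<^sup>2)"
      by (subst sum.reindex) (auto simp: inj_on_def)
    also have "\<dots> \<le> (\<Sum>k\<in>{-B..B} \<union> (\<lambda>i. c + int i) ` {..<t}. (?d k)\<^sup>2)"
      by (rule sum_mono2) auto
    also have "\<dots> = (\<Sum>k\<in>{-B..B}. (?d k)\<^sup>2)"
      by (rule sum.mono_neutral_right) (auto simp: B)
    finally show "(\<Sum>i<t. (?d (c + int i))\<^sup>2) \<le> (\<Sum>k\<in>{-B..B}. (?d k)\<^sup>2)" .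
  qed (use t in \<open>auto intro: sum_nonneg\<close>)
  finally show ?thesis
    by (simp add: mult.commute)
qed

text \<open>Two independent copies of a walker leave their intervals independently. If they are in the same region
  of size \<open>card S\<close>, this increases their mean distance, by an amount that controls the squared exit time.\<close>

lemma exit_time_le_distance_gain:
  fixes \<alpha> \<beta> x :: "'i \<Rightarrow> int" and w :: "'i \<Rightarrow> real"
  assumes I: "finite I" "J \<subseteq> I" and w: "\<And>i. i \<in> I \<Longrightarrow> 0 \<le> w i"
    and le: "\<And>i. i \<in> I \<Longrightarrow> \<alpha> i \<le> x i" "\<And>i. i \<in> I \<Longrightarrow> x i \<le> \<beta> i"
    and S: "finite S" "\<And>i. i \<in> J \<Longrightarrow> {\<alpha> i<..<\<beta> i} \<subseteq> S"
  shows "(\<Sum>i\<in>J. w i * ((real_of_int (x i) - real_of_int (\<alpha> i)) * (real_of_int (\<beta> i) - real_of_int (x i))))\<^sup>2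
    \<le> 2 * real (card S) ^ 3 *
      ((\<Sum>i\<in>I. \<Sum>j\<in>I. w i * w j *
          exit_mean (\<alpha> i) (\<beta> i) (x i) (\<lambda>a. exit_mean (\<alpha> j) (\<beta> j) (x j) (\<lambda>b. real_of_int \<bar>a - b\<bar>)))
       - (\<Sum>i\<in>I. \<Sum>j\<in>I. w i * w j * real_of_int \<bar>x i - x j\<bar>))" (is "?u\<^sup>2 \<le> 2 * _ * ?\<Delta>")
proof -
  define em where "em i = exit_mean (\<alpha> i) (\<beta> i) (x i)" for i
  define g where "g i = green (\<alpha> i) (\<beta> i) (x i)" for i
  \<comment> \<open>The mean occupation of site \<open>c\<close>. Its total is the mean exit time,
    and half its Dirichlet energy will bound the gain of distance from below.\<close>
  define G where "G c = (\<Sum>i\<in>J. w i * g i c)" for c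
  define B where "B = (\<Sum>i\<in>J. \<bar>\<alpha> i\<bar> + \<bar>\<beta> i\<bar>)"
  define E where "E = (\<Sum>k\<in>{-B..B}. (G (k + 1) - G k)\<^sup>2)"
  have J: "finite J" "\<And>i. i \<in> J \<Longrightarrow> i \<in> I"
    using I finite_subset by auto
  have B_ge: "- B \<le> \<alpha> i" "\<beta> i \<le> B" if "i \<in> J" for i
  proof -
    have "\<bar>\<alpha> i\<bar> + \<bar>\<beta> i\<bar> \<le> B"
      unfolding B_def using that J(1) by (intro member_le_sum) auto
    then show "- B \<le> \<alpha> i" "\<beta> i \<le> B"
      by linarith+
  qed
  have g_nonneg: "0 \<le> g i c" if "i \<in> I" for i c
    unfolding g_def using le[OF that] by (rule green_nonneg)
  have G_nonneg: "0 \<le> G c" for c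
    unfolding G_def using w g_nonneg J(2) by (intro sum_nonneg mult_nonneg_nonneg) auto
  have em_nonneg: "0 \<le> em i F" if "i \<in> I" "\<And>k. 0 \<le> F k" for i F
    using exit_mean_mono[OF le[OF that(1)], of "\<lambda>_. 0" F] that(2) by (simp add: em_def)
  have G_supp: "G c = 0" if "c \<notin> S" for c
  proof -
    have "g i c = 0" if "i \<in> J" for i
      unfolding g_def using le[OF J(2)[OF that]] S(2)[OF that] \<open>c \<notin> S\<close>
      by (intro green_eq_0) (auto simp: subset_eq not_less)
    then show ?thesis
      by (simp add: G_def)
  qed
  have G_B: "G c = 0" if "\<bar>c\<bar> \<ge> B" for c
  proof -
    have "g i c = 0" if "i \<in> J" for i
      unfolding g_def using le[OF J(2)[OF that]] B_ge[OF that] \<open>\<bar>c\<bar> \<ge> B\<close>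
      by (intro green_eq_0) auto
    then show ?thesis
      by (simp add: G_def)
  qed
  have u_eq: "?u = (\<Sum>c\<in>{-B..B}. G c)"
  proof -
    have "(real_of_int (x i) - real_of_int (\<alpha> i)) * (real_of_int (\<beta> i) - real_of_int (x i)) = (\<Sum>c\<in>{-B..B}. g i c)"
      if "i \<in> J" for i
    proof -
      \<comment> \<open>Squares have constant Laplacian 2, so Dynkin's formula turns the total
        occupation into the mean exit time.\<close>
      have "laplace (\<lambda>k. (real_of_int k)\<^sup>2) c = 2" for c
        by (simp add: laplace_def power2_eq_square algebra_simps)
      then show ?thesis
        using green_identity[OF le[OF J(2)[OF that]] B_ge[OF that], of "\<lambda>k. (real_of_int k)\<^sup>2"]
          exit_mean_square[OF le[OF J(2)[OF that]], of 0] by (simp add: g_def flip: sum_distrib_right)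
    qed
    then have "?u = (\<Sum>i\<in>J. \<Sum>c\<in>{-B..B}. w i * g i c)"
      by (simp add: sum_distrib_left)
    also have "\<dots> = (\<Sum>c\<in>{-B..B}. G c)"
      unfolding G_def by (rule sum.swap)
    finally show ?thesis .
  qed
  have energy: "(\<Sum>i\<in>J. w i * (G (x i) - em i G)) = E / 2"
  proof -
    have "(\<Sum>i\<in>J. w i * (G (x i) - em i G)) = (\<Sum>i\<in>J. - (w i * ((\<Sum>c\<in>{-B..B}. g i c * laplace G c) / 2)))"
    proof (rule sum.cong)
      fix i assume "i \<in> J"
      then show "w i * (G (x i) - em i G) = - (w i * ((\<Sum>c\<in>{-B..B}. g i c * laplace G c) / 2))"
        using green_identity[OF le[OF J(2)] B_ge, of i G] unfolding em_def[symmetric] g_def[symmetric]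
        by (metis minus_diff_eq mult_minus_right)
    qed simp
    also have "\<dots> = - (\<Sum>i\<in>J. \<Sum>c\<in>{-B..B}. w i * g i c * laplace G c) / 2"
      by (simp add: sum_distrib_left sum_negf sum_divide_distrib mult.assoc)
    also have "(\<Sum>i\<in>J. \<Sum>c\<in>{-B..B}. w i * g i c * laplace G c) = (\<Sum>c\<in>{-B..B}. G c * laplace G c)"
      unfolding G_def sum_distrib_right by (rule sum.swap)
    also have "- (\<Sum>c\<in>{-B..B}. G c * laplace G c) / 2 = E / 2"
      using laplace_by_parts(2)[of B G] G_B by (simp add: E_def)
    finally show ?thesis .
  qed
  have gain: "E / 2 \<le> ?\<Delta>"
  proof -
    \<comment> \<open>Move walker \<open>j\<close> first and walker \<open>i\<close> afterwards;
      each move adds a value of the Green function of the walker that moves.\<close>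
    have pair: "em i (\<lambda>a. em j (\<lambda>b. real_of_int \<bar>a - b\<bar>)) - real_of_int \<bar>x i - x j\<bar> = em i (g j) + g i (x j)" for i j
    proof -
      have "em j (\<lambda>b. real_of_int \<bar>a - b\<bar>) = g j a + real_of_int \<bar>a - x j\<bar>" for a
        by (simp add: em_def g_def green_def abs_minus_commute)
      then have "em i (\<lambda>a. em j (\<lambda>b. real_of_int \<bar>a - b\<bar>)) = em i (g j) + em i (\<lambda>a. real_of_int \<bar>a - x j\<bar>)"
        by (simp add: em_def exit_mean_add)
      then show ?thesis
        by (simp add: em_def g_def green_def)
    qed
    have "?\<Delta> = (\<Sum>i\<in>I. \<Sum>j\<in>I. w i * w j *
        (em i (\<lambda>a. em j (\<lambda>b. real_of_int \<bar>a - b\<bar>)) - real_of_int \<bar>x i - x j\<bar>))"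
      unfolding em_def right_diff_distrib sum_subtractf ..
    also have "\<dots> = (\<Sum>i\<in>I. \<Sum>j\<in>I. w i * w j * (em i (g j) + g i (x j)))"
      by (simp only: pair)
    also have "\<dots> \<ge> (\<Sum>i\<in>J. \<Sum>j\<in>I. w i * w j * (em i (g j) + g i (x j)))"
      using I w em_nonneg g_nonneg
      by (intro sum_mono2 sum_nonneg mult_nonneg_nonneg add_nonneg_nonneg) auto
    also have "(\<Sum>i\<in>J. \<Sum>j\<in>I. w i * w j * (em i (g j) + g i (x j))) \<ge> (\<Sum>i\<in>J. \<Sum>j\<in>J. w i * w j * g i (x j))"
    proof (rule sum_mono)
      fix i assume i: "i \<in> J"
      have "(\<Sum>j\<in>J. w i * w j * g i (x j)) \<le> (\<Sum>j\<in>J. w i * w j * (em i (g j) + g i (x j)))"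
        using i J(2) w em_nonneg g_nonneg by (intro sum_mono mult_left_mono) auto
      also have "\<dots> \<le> (\<Sum>j\<in>I. w i * w j * (em i (g j) + g i (x j)))"
        using i J(2) I w em_nonneg g_nonneg
        by (intro sum_mono2 mult_nonneg_nonneg add_nonneg_nonneg) auto
      finally show "(\<Sum>j\<in>J. w i * w j * g i (x j)) \<le> (\<Sum>j\<in>I. w i * w j * (em i (g j) + g i (x j)))" .
    qed
    also have "(\<Sum>i\<in>J. \<Sum>j\<in>J. w i * w j * g i (x j)) = (\<Sum>j\<in>J. w j * G (x j))"
      unfolding G_def sum_distrib_left by (subst sum.swap) (simp add: mult_ac)
    also have "(\<Sum>j\<in>J. w j * G (x j)) \<ge> (\<Sum>j\<in>J. w j * (G (x j) - em j G))"
      using J(2) w em_nonneg G_nonneg by (intro sum_mono mult_left_mono) auto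
    finally show ?thesis
      unfolding energy by simp
  qed
  \<comment> \<open>Cauchy-Schwarz over \<open>S\<close> gives one factor \<open>card S\<close>; the
    pointwise bound of \<open>square_le_energy\<close>, summed over \<open>S\<close>, gives the
    other two.\<close>
  have "(\<Sum>c\<in>{-B..B}. G c) = (\<Sum>c\<in>S \<inter> {-B..B}. G c)"
    using G_supp by (intro sum.mono_neutral_right) auto
  also have "(\<Sum>c\<in>S \<inter> {-B..B}. G c)\<^sup>2 \<le> (\<Sum>c\<in>S \<inter> {-B..B}. (G c)\<^sup>2) * real (card (S \<inter> {-B..B}))"
    by (rule sum_squared_le_sum_of_squares)
  also have "\<dots> \<le> (real (card (S \<inter> {-B..B})) * (real (card S) * E)) * real (card (S \<inter> {-B..B}))"
    unfolding E_def using S(1) G_supp G_B by (intro mult_right_mono sum_bounded_above square_le_energy) auto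
  also have "\<dots> \<le> (real (card S) * (real (card S) * E)) * real (card S)"
    using S(1) by (intro mult_mono of_nat_mono card_mono) (auto simp: E_def sum_nonneg)
  also have "\<dots> = 2 * real (card S) ^ 3 * (E / 2)"
    by (simp add: power3_eq_cube)
  also have "\<dots> \<le> 2 * real (card S) ^ 3 * ?\<Delta>"
    using gain by (intro mult_left_mono) auto
  finally show ?thesis
    unfolding u_eq .
qed

section \<open>The walk with a given vertical trajectory\<close>

text \<open>An unvisited \<open>x\<close> is its own end point on both sides: the interval
  degenerates and the walk departs vertically at once.\<close>

definition lo :: "(int \<times> int) set \<Rightarrow> int \<Rightarrow> int \<Rightarrow> int" where
  "lo A y x = x - int (LEAST n. (x - int n, y) \<notin> A)"

definition hi :: "(int \<times> int) set \<Rightarrow> int \<Rightarrow> int \<Rightarrow> int" where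
  "hi A y x = x + int (LEAST n. (x + int n, y) \<notin> A)"

lemma ex_unvisited:
  assumes "finite A"
  shows "\<exists>n. (x - int n, y) \<notin> A" "\<exists>n. (x + int n, y) \<notin> A"
proof -
  have "infinite (range (\<lambda>n. (x - int n, y)))" "infinite (range (\<lambda>n. (x + int n, y)))"
    by (auto intro!: range_inj_infinite simp: inj_on_def)
  then have "\<not> range (\<lambda>n. (x - int n, y)) \<subseteq> A" "\<not> range (\<lambda>n. (x + int n, y)) \<subseteq> A"
    using assms by (auto dest: finite_subset)
  then show "\<exists>n. (x - int n, y) \<notin> A" "\<exists>n. (x + int n, y) \<notin> A"
    by auto
qed

lemma lo_props:
  assumes "finite A"
  shows "lo A y x \<le> x" "(lo A y x, y) \<notin> A" "lo A y x < a \<Longrightarrow> a \<le> x \<Longrightarrow> (a, y) \<in> A"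
proof -
  let ?P = "\<lambda>n. (x - int n, y) \<notin> A"
  show "lo A y x \<le> x" "(lo A y x, y) \<notin> A"
    using LeastI_ex[of ?P] ex_unvisited(1)[OF assms] by (simp_all add: lo_def)
  assume "lo A y x < a" "a \<le> x"
  then have "nat (x - a) < (LEAST n. ?P n)"
    unfolding lo_def by linarith
  then have "\<not> ?P (nat (x - a))"
    by (rule not_less_Least)
  then show "(a, y) \<in> A"
    using \<open>a \<le> x\<close> by simp
qed

lemma hi_props:
  assumes "finite A"
  shows "x \<le> hi A y x" "(hi A y x, y) \<notin> A" "x \<le> a \<Longrightarrow> a < hi A y x \<Longrightarrow> (a, y) \<in> A"
proof -
  let ?P = "\<lambda>n. (x + int n, y) \<notin> A"
  show "x \<le> hi A y x" "(hi A y x, y) \<notin> A"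
    using LeastI_ex[of ?P] ex_unvisited(2)[OF assms] by (simp_all add: hi_def)
  assume "x \<le> a" "a < hi A y x"
  then have "nat (a - x) < (LEAST n. ?P n)"
    unfolding hi_def by linarith
  then have "\<not> ?P (nat (a - x))"
    by (rule not_less_Least)
  then show "(a, y) \<in> A"
    using \<open>x \<le> a\<close> by simp
qed

lemma lo_eqI:
  assumes "finite A" "a \<le> x" "(a, y) \<notin> A" "\<And>k. a < k \<Longrightarrow> k \<le> x \<Longrightarrow> (k, y) \<in> A"
  shows "lo A y x = a"
  using lo_props[OF assms(1), where x = x and y = y] assms(2-4) by (metis linorder_neqE_linordered_idom)

lemma hi_eqI:
  assumes "finite A" "x \<le> a" "(a, y) \<notin> A" "\<And>k. x \<le> k \<Longrightarrow> k < a \<Longrightarrow> (k, y) \<in> A"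
  shows "hi A y x = a"
  using hi_props[OF assms(1), where x = x and y = y] assms(2-4) by (metis linorder_neqE_linordered_idom)

lemma visited_between:
  assumes "finite A" "lo A y x < a" "a < hi A y x"
  shows "(a, y) \<in> A"
  using lo_props(3)[OF assms(1,2)] hi_props(3)[OF assms(1) _ assms(3)] by linarith

lemma lo_hi_unvisited:
  assumes "(x, y) \<notin> A" "finite A"
  shows "lo A y x = x" "hi A y x = x"
  using assms by (auto intro: lo_eqI hi_eqI)

text \<open>The vertical trajectory is a fixed sequence \<open>lev\<close>, and a state \<open>\<sigma>\<close> consists of the set of visited sites
  and the horizontal coordinate. The walk moves horizontally until it finds an unvisited site, from which it
  departs vertically: \<open>sojourn\<close> is the mean duration of the horizontal motion, and \<open>exit_exp\<close> and \<open>exit_pmf\<close>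
  describe the state after it.\<close>

definition sojourn :: "int \<Rightarrow> (int \<times> int) set \<times> int \<Rightarrow> real" where
  "sojourn y \<sigma> = (real_of_int (snd \<sigma>) - real_of_int (lo (fst \<sigma>) y (snd \<sigma>))) *
                 (real_of_int (hi (fst \<sigma>) y (snd \<sigma>)) - real_of_int (snd \<sigma>))"

definition exit_exp :: "int \<Rightarrow> (int \<times> int) set \<times> int \<Rightarrow> ((int \<times> int) set \<times> int \<Rightarrow> real) \<Rightarrow> real" where
  "exit_exp y \<sigma> f = exit_mean (lo (fst \<sigma>) y (snd \<sigma>)) (hi (fst \<sigma>) y (snd \<sigma>)) (snd \<sigma>)
     (\<lambda>a. f (insert (a, y) (fst \<sigma>), a))"

text \<open>The summand 1 is the vertical departure that follows the horizontal motion.\<close>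

primrec mean_time :: "nat \<Rightarrow> (nat \<Rightarrow> int) \<Rightarrow> (int \<times> int) set \<times> int \<Rightarrow> real" where
  "mean_time 0 lev \<sigma> = 0"
| "mean_time (Suc k) lev \<sigma> = 1 + sojourn (lev 0) \<sigma> + exit_exp (lev 0) \<sigma> (mean_time k (\<lambda>i. lev (Suc i)))"

definition exit_pmf :: "int \<Rightarrow> (int \<times> int) set \<times> int \<Rightarrow> ((int \<times> int) set \<times> int) pmf" where
  "exit_pmf y \<sigma> = (let \<alpha> = lo (fst \<sigma>) y (snd \<sigma>); \<beta> = hi (fst \<sigma>) y (snd \<sigma>) in
     map_pmf (\<lambda>c. let a = (if c then \<beta> else \<alpha>) in (insert (a, y) (fst \<sigma>), a))
       (bernoulli_pmf (exit_prob \<alpha> \<beta> (snd \<sigma>))))"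

primrec law :: "(nat \<Rightarrow> int) \<Rightarrow> (int \<times> int) set \<times> int \<Rightarrow> nat \<Rightarrow> ((int \<times> int) set \<times> int) pmf" where
  "law lev \<sigma> 0 = return_pmf \<sigma>"
| "law lev \<sigma> (Suc i) = bind_pmf (law lev \<sigma> i) (exit_pmf (lev i))"

text \<open>The laws below have finite support, and with finite sums the rules for expectations
  carry no integrability conditions.\<close>

definition E :: "'s pmf \<Rightarrow> ('s \<Rightarrow> real) \<Rightarrow> real" where
  "E p f = (\<Sum>s\<in>set_pmf p. pmf p s * f s)"

lemma finite_exit_pmf: "finite (set_pmf (exit_pmf y \<sigma>))"
  by (simp add: exit_pmf_def Let_def)

lemma finite_law: "finite (set_pmf (law lev \<sigma> i))"
  by (induction i) (simp_all add: finite_exit_pmf)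

lemma E_eq_expectation: "finite (set_pmf p) \<Longrightarrow> E p f = measure_pmf.expectation p f"
  by (subst integral_measure_pmf_real[of "set_pmf p"]) (auto simp: E_def mult.commute)

lemma E_exit_pmf:
  assumes "finite (fst \<sigma>)"
  shows "E (exit_pmf y \<sigma>) f = exit_exp y \<sigma> f"
proof -
  have "0 \<le> exit_prob (lo (fst \<sigma>) y (snd \<sigma>)) (hi (fst \<sigma>) y (snd \<sigma>)) (snd \<sigma>)"
    "exit_prob (lo (fst \<sigma>) y (snd \<sigma>)) (hi (fst \<sigma>) y (snd \<sigma>)) (snd \<sigma>) \<le> 1"
    using lo_props(1)[OF assms] hi_props(1)[OF assms] by (auto intro: exit_prob_bounds)
  then show ?thesis
    by (simp add: E_eq_expectation finite_exit_pmf) (simp add: exit_pmf_def exit_exp_def exit_mean_def Let_def)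
qed

text \<open>Every exit ends at a site that is new on its level. So the number of visited sites on a
  level is determined by \<open>A\<close> and \<open>lev\<close>, although their positions are
  random.\<close>

lemma law_props:
  assumes "finite A" and "\<tau> \<in> set_pmf (law lev (A, x) i)"
  shows "finite (fst \<tau>)" "A \<subseteq> fst \<tau>"
    "card {a. (a, y) \<in> fst \<tau>} = card {a. (a, y) \<in> A} + card {j. j < i \<and> lev j = y}"
proof -
  have row_finite: "finite {a. (a, y) \<in> B}" if "finite B" for B :: "(int \<times> int) set" and y
    by (rule finite_subset[of _ "fst ` B"]) (use that in force)+
  have "finite (fst \<tau>) \<and> A \<subseteq> fst \<tau> \<and>
      (\<forall>y. card {a. (a, y) \<in> fst \<tau>} = card {a. (a, y) \<in> A} + card {j. j < i \<and> lev j = y})"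
    using assms(2)
  proof (induction i arbitrary: \<tau>)
    case 0
    then show ?case
      using assms(1) by simp
  next
    case (Suc i)
    then obtain \<sigma> where \<sigma>: "\<sigma> \<in> set_pmf (law lev (A, x) i)" and \<tau>: "\<tau> \<in> set_pmf (exit_pmf (lev i) \<sigma>)"
      by auto
    have fin: "finite (fst \<sigma>)"
      using Suc.IH[OF \<sigma>] by simp
    obtain a where a: "fst \<tau> = insert (a, lev i) (fst \<sigma>)" "(a, lev i) \<notin> fst \<sigma>"
      using \<tau> lo_props(2)[OF fin] hi_props(2)[OF fin] by (auto simp: exit_pmf_def Let_def)
    have "card {c. (c, y) \<in> fst \<tau>} = card {c. (c, y) \<in> A} + card {j. j < Suc i \<and> lev j = y}" for y
    proof (cases "lev i = y")
      case True
      have "{c. (c, y) \<in> fst \<tau>} = insert a {c. (c, y) \<in> fst \<sigma>}"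
        using a True by auto
      moreover have "{j. j < Suc i \<and> lev j = y} = insert i {j. j < i \<and> lev j = y}"
        using True by auto
      ultimately show ?thesis
        using a True Suc.IH[OF \<sigma>] row_finite[OF fin] by simp
    next
      case False
      have "{c. (c, y) \<in> fst \<tau>} = {c. (c, y) \<in> fst \<sigma>}"
        using a False by auto
      moreover have "{j. j < Suc i \<and> lev j = y} = {j. j < i \<and> lev j = y}"
        using False by (auto simp: less_Suc_eq)
      ultimately show ?thesis
        using Suc.IH[OF \<sigma>] by simp
    qed
    then show ?case
      using Suc.IH[OF \<sigma>] a by auto
  qed
  then show "finite (fst \<tau>)" "A \<subseteq> fst \<tau>"
    "card {a. (a, y) \<in> fst \<tau>} = card {a. (a, y) \<in> A} + card {j. j < i \<and> lev j = y}"
    by auto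
qed

lemma E_law_Suc:
  assumes "finite A"
  shows "E (law lev (A, x) (Suc i)) f = E (law lev (A, x) i) (\<lambda>\<sigma>. exit_exp (lev i) \<sigma> f)"
proof -
  have "E (law lev (A, x) (Suc i)) f = measure_pmf.expectation (law lev (A, x) (Suc i)) f"
    by (rule E_eq_expectation[OF finite_law])
  also have "\<dots> = (\<Sum>\<sigma>\<in>set_pmf (law lev (A, x) i). pmf (law lev (A, x) i) \<sigma> *\<^sub>R measure_pmf.expectation (exit_pmf (lev i) \<sigma>) f)"
    unfolding law.simps by (rule pmf_expectation_bind) (auto simp: finite_law finite_exit_pmf)
  also have "\<dots> = E (law lev (A, x) i) (\<lambda>\<sigma>. exit_exp (lev i) \<sigma> f)"
    unfolding E_def
  proof (rule sum.cong)
    fix \<sigma> assume "\<sigma> \<in> set_pmf (law lev (A, x) i)"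
    then show "pmf (law lev (A, x) i) \<sigma> *\<^sub>R measure_pmf.expectation (exit_pmf (lev i) \<sigma>) f =
        pmf (law lev (A, x) i) \<sigma> * exit_exp (lev i) \<sigma> f"
      using law_props(1)[OF assms] by (simp add: E_eq_expectation[OF finite_exit_pmf, symmetric] E_exit_pmf)
  qed simp
  finally show ?thesis .
qed

lemma E_return [simp]: "E (return_pmf s) f = f s"
  by (simp add: E_def)

lemma E_add: "E p (\<lambda>s. f s + g s) = E p f + E p g"
  by (simp add: E_def algebra_simps sum.distrib)

lemma E_mult: "E p (\<lambda>s. c * f s) = c * E p f"
  by (simp add: E_def sum_distrib_left mult_ac)

lemma E_const: "finite (set_pmf p) \<Longrightarrow> E p (\<lambda>_. c) = c"
  by (simp add: E_eq_expectation)

lemma E_mono: "(\<And>s. s \<in> set_pmf p \<Longrightarrow> f s \<le> g s) \<Longrightarrow> E p f \<le> E p g"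
  unfolding E_def by (intro sum_mono mult_left_mono) auto

lemma E_cong: "(\<And>s. s \<in> set_pmf p \<Longrightarrow> f s = g s) \<Longrightarrow> E p f = E p g"
  unfolding E_def by (intro sum.cong) auto

lemma E_nonneg: "(\<And>s. s \<in> set_pmf p \<Longrightarrow> 0 \<le> f s) \<Longrightarrow> 0 \<le> E p f"
  unfolding E_def by (intro sum_nonneg mult_nonneg_nonneg) auto

text \<open>The Markov property at the \<open>k\<close>-th vertical step; it connects
  \<open>mean_time\<close>, which unfolds at the first step, with \<open>law\<close>, which unfolds
  at the last.\<close>

lemma mean_time_add:
  assumes "finite A"
  shows "mean_time (k + m) lev (A, x) = (\<Sum>i<k. 1 + E (law lev (A, x) i) (sojourn (lev i)))
     + E (law lev (A, x) k) (mean_time m (\<lambda>i. lev (k + i)))"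
proof (induction k arbitrary: m)
  case 0
  then show ?case
    by simp
next
  case (Suc k)
  have "mean_time (Suc k + m) lev (A, x) = (\<Sum>i<k. 1 + E (law lev (A, x) i) (sojourn (lev i)))
     + E (law lev (A, x) k) (mean_time (Suc m) (\<lambda>i. lev (k + i)))"
    using Suc.IH[of "Suc m"] by (simp only: add_Suc add_Suc_right)
  also have "E (law lev (A, x) k) (mean_time (Suc m) (\<lambda>i. lev (k + i))) =
      1 + E (law lev (A, x) k) (sojourn (lev k)) + E (law lev (A, x) (Suc k)) (mean_time m (\<lambda>i. lev (Suc k + i)))"
    unfolding E_law_Suc[OF assms] mean_time.simps E_add E_const[OF finite_law] by simp
  finally show ?case
    by simp
qed

section \<open>Two independent copies with the same vertical trajectory\<close>

definition spread :: "((int \<times> int) set \<times> int) pmf \<Rightarrow> real" where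
  "spread p = E p (\<lambda>\<sigma>. E p (\<lambda>\<tau>. real_of_int \<bar>snd \<sigma> - snd \<tau>\<bar>))"

lemma spread_law_Suc:
  assumes "finite A"
  shows "spread (law lev (A, x) (Suc i)) =
    E (law lev (A, x) i) (\<lambda>\<sigma>. E (law lev (A, x) i) (\<lambda>\<tau>.
      exit_mean (lo (fst \<sigma>) (lev i) (snd \<sigma>)) (hi (fst \<sigma>) (lev i) (snd \<sigma>)) (snd \<sigma>) (\<lambda>a.
        exit_mean (lo (fst \<tau>) (lev i) (snd \<tau>)) (hi (fst \<tau>) (lev i) (snd \<tau>)) (snd \<tau>) (\<lambda>b. real_of_int \<bar>a - b\<bar>))))"
  unfolding spread_def E_law_Suc[OF assms] by (simp add: exit_exp_def E_def exit_mean_sum exit_mean_mult)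

text \<open>The states in the support act as the family of walkers, weighted by their
  probabilities.\<close>

lemma sojourn_le_spread_gain:
  assumes "finite A" and "J \<subseteq> set_pmf (law lev (A, x) i)" and "finite S"
    and "\<And>\<sigma>. \<sigma> \<in> J \<Longrightarrow> {lo (fst \<sigma>) (lev i) (snd \<sigma>)<..<hi (fst \<sigma>) (lev i) (snd \<sigma>)} \<subseteq> S"
  shows "(\<Sum>\<sigma>\<in>J. pmf (law lev (A, x) i) \<sigma> * sojourn (lev i) \<sigma>)\<^sup>2
     \<le> 2 * real (card S) ^ 3 * (spread (law lev (A, x) (Suc i)) - spread (law lev (A, x) i))"
  unfolding sojourn_def spread_law_Suc[OF assms(1)]
  unfolding spread_def E_def sum_distrib_left mult.assoc[symmetric]
  using exit_time_le_distance_gain[of "set_pmf (law lev (A, x) i)" J "pmf (law lev (A, x) i)"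
    "\<lambda>\<sigma>. lo (fst \<sigma>) (lev i) (snd \<sigma>)" snd "\<lambda>\<sigma>. hi (fst \<sigma>) (lev i) (snd \<sigma>)" S]
    assms(2-4) finite_law lo_props(1)[OF law_props(1)[OF assms(1)]] hi_props(1)[OF law_props(1)[OF assms(1)]]
  by (simp add: mult.assoc)

text \<open>The horizontal coordinate is a martingale, and \<open>sojourn\<close> is the conditional
  variance of its increment at an exit.\<close>

lemma E_square_displacement:
  assumes "finite A"
  shows "E (law lev (A, x) k) (\<lambda>\<sigma>. (real_of_int (snd \<sigma>) - real_of_int x)\<^sup>2) =
    (\<Sum>i<k. E (law lev (A, x) i) (sojourn (lev i)))"
proof (induction k)
  case (Suc k)
  have "exit_exp (lev k) \<sigma> (\<lambda>\<sigma>. (real_of_int (snd \<sigma>) - real_of_int x)\<^sup>2) =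
      (real_of_int (snd \<sigma>) - real_of_int x)\<^sup>2 + sojourn (lev k) \<sigma>" if "\<sigma> \<in> set_pmf (law lev (A, x) k)" for \<sigma>
    using law_props(1)[OF assms that] unfolding exit_exp_def snd_conv
    by (subst exit_mean_square) (auto simp: lo_props hi_props sojourn_def)
  then show ?case
    unfolding E_law_Suc[OF assms] using Suc.IH by (simp add: E_add cong: E_cong)
qed simp

text \<open>Triangle inequality through the starting point, then first moment against second
  moment.\<close>

lemma spread_le:
  assumes "finite A"
  shows "spread (law lev (A, x) k) \<le> 2 * sqrt (\<Sum>i<k. E (law lev (A, x) i) (sojourn (lev i)))"
proof -
  define p where "p = law lev (A, x) k"
  define f where "f \<sigma> = \<bar>real_of_int (snd \<sigma>) - real_of_int x\<bar>" for \<sigma> :: "(int \<times> int) set \<times> int"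
  have fin: "finite (set_pmf p)"
    unfolding p_def by (rule finite_law)
  have "spread p \<le> E p (\<lambda>\<sigma>. E p (\<lambda>\<tau>. f \<sigma> + f \<tau>))"
    unfolding spread_def f_def by (intro E_mono) auto
  also have "\<dots> = 2 * E p f"
    unfolding E_add E_const[OF fin] by simp
  finally have spread: "spread p \<le> 2 * E p f" .
  have "0 \<le> E p (\<lambda>\<sigma>. (f \<sigma> - E p f)\<^sup>2)"
    by (intro E_nonneg) auto
  also have "\<dots> = E p (\<lambda>\<sigma>. (f \<sigma>)\<^sup>2 + ((- 2 * E p f) * f \<sigma> + (E p f)\<^sup>2))"
    by (intro E_cong) (simp add: power2_eq_square algebra_simps)
  also have "\<dots> = E p (\<lambda>\<sigma>. (f \<sigma>)\<^sup>2) - (E p f)\<^sup>2"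
  proof -
    show ?thesis
      unfolding E_add E_const[OF fin] E_mult by (simp add: power2_eq_square)
  qed
  finally have "E p f \<le> sqrt (E p (\<lambda>\<sigma>. (f \<sigma>)\<^sup>2))"
    by (intro real_le_rsqrt) simp
  then show ?thesis
    using spread E_square_displacement[OF assms, of lev x k] by (simp add: p_def f_def)
qed

text \<open>Sites around which the level is dense enough for a long interval to arise by adding \<open>b\<close> new sites.\<close>

definition dense_sites :: "nat \<Rightarrow> int set \<Rightarrow> int set" where
  "dense_sites b R = {c. b \<le> card {a \<in> R. \<bar>a - c\<bar> \<le> 2 * int b}}"

text \<open>Double counting: a dense site has at least \<open>b\<close> points of \<open>R\<close>
  within distance \<open>2 * b\<close>, and a point of \<open>R\<close> is that close to at most
  \<open>4 * b + 1 \<le> 5 * b\<close> sites.\<close>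

lemma dense_sites:
  assumes "finite R" "b > 0"
  shows "finite (dense_sites b R)" "card (dense_sites b R) \<le> 5 * card R"
proof -
  have "dense_sites b R \<subseteq> (\<Union>a\<in>R. {a - 2 * int b..a + 2 * int b})"
  proof
    fix c assume "c \<in> dense_sites b R"
    then have "card {a \<in> R. \<bar>a - c\<bar> \<le> 2 * int b} > 0"
      using assms(2) by (simp add: dense_sites_def)
    then obtain a where "a \<in> R" "\<bar>a - c\<bar> \<le> 2 * int b"
      by (auto simp: card_gt_0_iff)
    then show "c \<in> (\<Union>a\<in>R. {a - 2 * int b..a + 2 * int b})"
      by (intro UN_I[of a]) auto
  qed
  then show fin: "finite (dense_sites b R)"
    by (rule finite_subset) (use assms in auto)
  have "card (dense_sites b R) * b = (\<Sum>c\<in>dense_sites b R. b)"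
    by simp
  also have "\<dots> \<le> (\<Sum>c\<in>dense_sites b R. card {a \<in> R. \<bar>a - c\<bar> \<le> 2 * int b})"
    by (intro sum_mono) (auto simp: dense_sites_def)
  also have "\<dots> = (\<Sum>a\<in>R. card {c \<in> dense_sites b R. \<bar>a - c\<bar> \<le> 2 * int b})"
    using sum_multicount_gen[OF fin assms(1), of "\<lambda>c a. \<bar>a - c\<bar> \<le> 2 * int b"
      "\<lambda>a. card {c \<in> dense_sites b R. \<bar>a - c\<bar> \<le> 2 * int b}"] by simp
  also have "\<dots> \<le> (\<Sum>a\<in>R. 5 * b)"
  proof (rule sum_mono)
    fix a
    have "card {c \<in> dense_sites b R. \<bar>a - c\<bar> \<le> 2 * int b} \<le> card {a - 2 * int b..a + 2 * int b}"
      by (rule card_mono) auto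
    also have "\<dots> \<le> 5 * b"
      using assms(2) by simp
    finally show "card {c \<in> dense_sites b R. \<bar>a - c\<bar> \<le> 2 * int b} \<le> 5 * b" .
  qed
  finally show "card (dense_sites b R) \<le> 5 * card R"
    using assms(2) by (simp add: mult_ac)
qed

text \<open>At least \<open>2 * b\<close> sites of the interval lie within distance
  \<open>2 * b\<close> of \<open>c\<close>, and at most \<open>b\<close> of them are outside
  \<open>R\<close>.\<close>

lemma long_interval_subset_dense:
  fixes \<alpha> \<beta> :: int
  assumes "2 * int b < \<beta> - \<alpha>" "{\<alpha><..<\<beta>} \<subseteq> R'" "R \<subseteq> R'" "finite R'" "card R' \<le> card R + b"
  shows "{\<alpha><..<\<beta>} \<subseteq> dense_sites b R"
proof
  fix c assume c: "c \<in> {\<alpha><..<\<beta>}"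
  let ?W = "{max (\<alpha> + 1) (c - 2 * int b)..min (\<beta> - 1) (c + 2 * int b)}"
  have "2 * b \<le> card ?W"
    using assms(1) c by (auto simp: max_def min_def)
  also have "card ?W \<le> card ({a \<in> R. \<bar>a - c\<bar> \<le> 2 * int b} \<union> (R' - R))"
  proof (rule card_mono)
    show "finite ({a \<in> R. \<bar>a - c\<bar> \<le> 2 * int b} \<union> (R' - R))"
      using assms(4) finite_subset[OF assms(3,4)] by simp
    show "?W \<subseteq> {a \<in> R. \<bar>a - c\<bar> \<le> 2 * int b} \<union> (R' - R)"
    proof
      fix a assume "a \<in> ?W"
      then have "a \<in> {\<alpha><..<\<beta>}" "\<bar>a - c\<bar> \<le> 2 * int b"
        by auto
      then show "a \<in> {a \<in> R. \<bar>a - c\<bar> \<le> 2 * int b} \<union> (R' - R)"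
        using assms(2) by blast
    qed
  qed
  also have "\<dots> \<le> card {a \<in> R. \<bar>a - c\<bar> \<le> 2 * int b} + card (R' - R)"
    by (rule card_Un_le)
  also have "card (R' - R) \<le> b"
    using assms(3-5) by (simp add: card_Diff_subset finite_subset)
  finally show "c \<in> dense_sites b R"
    by (simp add: dense_sites_def)
qed

text \<open>Short intervals contribute at most \<open>b^2\<close> each. If the part \<open>Q\<close>
  from long intervals dominates the total \<open>V\<close>, then \<open>V \<le> 2 * Q\<close> closes
  the inequality \<open>Q^2 \<le> 4 * q^3 * (5 * L)^3 * sqrt V\<close>, and it can be solved for
  \<open>Q\<close>.\<close>

lemma window_sojourn_le:
  fixes q L b :: nat
  assumes "finite A" "b > 0" and row: "\<And>y. card {a. (a, y) \<in> A} \<le> L"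
    and visits: "\<And>y. card {i. i < q ^ 3 \<and> lev i = y} \<le> b"
  shows "(\<Sum>i<q ^ 3. E (law lev (A, x) i) (sojourn (lev i))) \<le> 2 * real q ^ 3 * (real b)\<^sup>2 + 200 * (real q)\<^sup>2 * (real L)\<^sup>2"
proof -
  define k where "k = q ^ 3"
  define p where "p i = law lev (A, x) i" for i
  define long where "long i = {\<sigma> \<in> set_pmf (p i). 2 * int b < hi (fst \<sigma>) (lev i) (snd \<sigma>) - lo (fst \<sigma>) (lev i) (snd \<sigma>)}" for i
  define P where "P i = (\<Sum>\<sigma>\<in>long i. pmf (p i) \<sigma> * sojourn (lev i) \<sigma>)" for i
  define V where "V = (\<Sum>i<k. E (p i) (sojourn (lev i)))"
  have fin: "finite (fst \<sigma>)" if "\<sigma> \<in> set_pmf (p i)" for \<sigma> i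
    using law_props(1)[OF assms(1)] that unfolding p_def .
  have row_finite: "finite {a. (a, y) \<in> B}" if "finite B" for B :: "(int \<times> int) set" and y
    by (rule finite_subset[of _ "fst ` B"]) (use that in force)+
  have soj_nonneg: "0 \<le> sojourn (lev i) \<sigma>" if "\<sigma> \<in> set_pmf (p i)" for i \<sigma>
    using lo_props(1)[OF fin[OF that]] hi_props(1)[OF fin[OF that]] by (simp add: sojourn_def)
  have P_nonneg: "0 \<le> P i" for i
    unfolding P_def by (intro sum_nonneg mult_nonneg_nonneg soj_nonneg) (auto simp: long_def)
  have split: "E (p i) (sojourn (lev i)) \<le> P i + (real b)\<^sup>2" for i
  proof -
    have finp: "finite (set_pmf (p i))"
      unfolding p_def by (rule finite_law)
    have "E (p i) (sojourn (lev i)) = P i + (\<Sum>\<sigma>\<in>set_pmf (p i) - long i. pmf (p i) \<sigma> * sojourn (lev i) \<sigma>)"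
      unfolding E_def P_def using finp by (subst sum.subset_diff[of "long i"]) (auto simp: long_def)
    also have "(\<Sum>\<sigma>\<in>set_pmf (p i) - long i. pmf (p i) \<sigma> * sojourn (lev i) \<sigma>)
        \<le> (\<Sum>\<sigma>\<in>set_pmf (p i) - long i. pmf (p i) \<sigma> * (real b)\<^sup>2)"
    proof (intro sum_mono mult_left_mono)
      fix \<sigma> assume \<sigma>: "\<sigma> \<in> set_pmf (p i) - long i"
      define s t where "s = real_of_int (snd \<sigma>) - real_of_int (lo (fst \<sigma>) (lev i) (snd \<sigma>))"
        and "t = real_of_int (hi (fst \<sigma>) (lev i) (snd \<sigma>)) - real_of_int (snd \<sigma>)"
      have "0 \<le> s" "0 \<le> t"
        using lo_props(1)[OF fin[of \<sigma> i]] hi_props(1)[OF fin[of \<sigma> i]] \<sigma> by (simp_all add: s_def t_def)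
      moreover have "hi (fst \<sigma>) (lev i) (snd \<sigma>) - lo (fst \<sigma>) (lev i) (snd \<sigma>) \<le> 2 * int b"
        using \<sigma> by (auto simp: long_def)
      then have "s + t \<le> 2 * real b"
        unfolding s_def t_def by linarith
      ultimately have "(s + t)\<^sup>2 \<le> (2 * real b)\<^sup>2"
        by (intro power_mono) auto
      moreover have "4 * (s * t) \<le> (s + t)\<^sup>2"
        using zero_le_power2[of "s - t"] by (simp add: power2_eq_square algebra_simps)
      ultimately show "sojourn (lev i) \<sigma> \<le> (real b)\<^sup>2"
        by (simp add: sojourn_def s_def t_def power_mult_distrib)
    qed auto
    also have "\<dots> \<le> E (p i) (\<lambda>_. (real b)\<^sup>2)"
      unfolding E_def using finp by (intro sum_mono2) auto
    also have "\<dots> = (real b)\<^sup>2"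
      by (rule E_const[OF finp])
    finally show ?thesis
      by simp
  qed
  have P_sq: "(P i)\<^sup>2 \<le> 2 * (5 * real L) ^ 3 * (spread (p (Suc i)) - spread (p i))" if "i < k" for i
  proof -
    define R where "R = {a. (a, lev i) \<in> A}"
    define S where "S = dense_sites b R"
    have R: "finite R"
      unfolding R_def using row_finite[OF assms(1)] .
    have sub: "{lo (fst \<sigma>) (lev i) (snd \<sigma>)<..<hi (fst \<sigma>) (lev i) (snd \<sigma>)} \<subseteq> S" if "\<sigma> \<in> long i" for \<sigma>
      unfolding S_def
    proof (rule long_interval_subset_dense[where R' = "{a. (a, lev i) \<in> fst \<sigma>}"])
      have \<sigma>: "\<sigma> \<in> set_pmf (law lev (A, x) i)"
        using that by (simp add: long_def p_def)
      show "2 * int b < hi (fst \<sigma>) (lev i) (snd \<sigma>) - lo (fst \<sigma>) (lev i) (snd \<sigma>)"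
        using that by (simp add: long_def)
      show "{lo (fst \<sigma>) (lev i) (snd \<sigma>)<..<hi (fst \<sigma>) (lev i) (snd \<sigma>)} \<subseteq> {a. (a, lev i) \<in> fst \<sigma>}"
        using visited_between[OF law_props(1)[OF assms(1) \<sigma>]] by auto
      show "R \<subseteq> {a. (a, lev i) \<in> fst \<sigma>}"
        using law_props(2)[OF assms(1) \<sigma>] by (auto simp: R_def)
      show "finite {a. (a, lev i) \<in> fst \<sigma>}"
        using row_finite[OF law_props(1)[OF assms(1) \<sigma>]] .
      have "card {j. j < i \<and> lev j = lev i} \<le> card {j. j < q ^ 3 \<and> lev j = lev i}"
        using \<open>i < k\<close> by (intro card_mono) (auto simp: k_def)
      then show "card {a. (a, lev i) \<in> fst \<sigma>} \<le> card R + b"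
        using law_props(3)[OF assms(1) \<sigma>, of "lev i"] visits[of "lev i"] by (simp add: R_def)
    qed
    have "(P i)\<^sup>2 \<le> 2 * real (card S) ^ 3 * (spread (p (Suc i)) - spread (p i))"
      unfolding P_def p_def using sub dense_sites(1)[OF R assms(2)]
      by (intro sojourn_le_spread_gain[OF assms(1)]) (auto simp: S_def long_def p_def)
    also have "\<dots> \<le> 2 * (5 * real L) ^ 3 * (spread (p (Suc i)) - spread (p i))"
    proof (intro mult_right_mono mult_left_mono power_mono)
      have "card S \<le> 5 * L"
        using dense_sites(2)[OF R assms(2)] row[of "lev i"] by (simp add: S_def R_def)
      then show "real (card S) \<le> 5 * real L"
        by linarith
      \<comment> \<open>An empty family of walkers and any set of one site show that
        \<open>spread\<close> never decreases.\<close>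
      show "0 \<le> spread (p (Suc i)) - spread (p i)"
        using sojourn_le_spread_gain[OF assms(1), of "{}" lev x i "{0}"] by (simp add: p_def)
    qed auto
    finally show ?thesis .
  qed
  define Q where "Q = (\<Sum>i<k. P i)"
  have V_nonneg: "0 \<le> V"
    unfolding V_def using soj_nonneg by (intro sum_nonneg E_nonneg) auto
  \<comment> \<open>Cauchy-Schwarz over the steps of the window, after which the gains of
    \<open>spread\<close> telescope.\<close>
  have "Q\<^sup>2 \<le> (\<Sum>i<k. (P i)\<^sup>2) * real (card {..<k})"
    unfolding Q_def by (rule sum_squared_le_sum_of_squares)
  also have "\<dots> \<le> (\<Sum>i<k. 2 * (5 * real L) ^ 3 * (spread (p (Suc i)) - spread (p i))) * real k"
    using P_sq by (intro mult_mono sum_mono) (auto intro: order_trans[OF zero_le_power2] sum_nonneg)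
  also have "\<dots> = 2 * (5 * real L) ^ 3 * (spread (p k) - spread (p 0)) * real k"
    using sum_lessThan_telescope[of "\<lambda>i. spread (p i)" k] by (simp flip: sum_distrib_left)
  also have "\<dots> \<le> 2 * (5 * real L) ^ 3 * (2 * sqrt V) * real k"
    using spread_le[OF assms(1), of lev x k] by (intro mult_right_mono mult_left_mono) (auto simp: p_def V_def spread_def)
  finally have Q_sq: "Q\<^sup>2 \<le> 4 * real k * (5 * real L) ^ 3 * sqrt V"
    by (simp add: mult_ac)
  have V_le: "V \<le> Q + real k * (real b)\<^sup>2"
  proof -
    have "V \<le> (\<Sum>i<k. P i + (real b)\<^sup>2)"
      unfolding V_def using split by (intro sum_mono)
    then show ?thesis
      by (simp add: Q_def sum.distrib)
  qed
  have "V \<le> 2 * real k * (real b)\<^sup>2 + 200 * (real q)\<^sup>2 * (real L)\<^sup>2"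
  proof (cases "Q \<le> real k * (real b)\<^sup>2")
    case True
    moreover have "0 \<le> 200 * (real q)\<^sup>2 * (real L)\<^sup>2"
      by simp
    ultimately show ?thesis
      using V_le by linarith
  next
    case False
    then have V2: "V \<le> 2 * Q" and Q_pos: "0 < Q"
      using V_le by (auto simp: not_le intro: le_less_trans[rotated])
    have "Q ^ 4 = (Q\<^sup>2)\<^sup>2"
      by simp
    also have "\<dots> \<le> (4 * real k * (5 * real L) ^ 3 * sqrt V)\<^sup>2"
      using Q_sq by (intro power_mono) auto
    also have "\<dots> = 16 * (real k)\<^sup>2 * (5 * real L) ^ 6 * V"
      using V_nonneg by (simp add: power_mult_distrib)
    also have "\<dots> \<le> 16 * (real k)\<^sup>2 * (5 * real L) ^ 6 * (2 * Q)"
      using V2 by (intro mult_left_mono) auto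
    finally have "Q ^ 3 * Q \<le> 32 * (real k)\<^sup>2 * (5 * real L) ^ 6 * Q"
      by (simp add: power4_eq_xxxx power3_eq_cube mult_ac)
    then have "Q ^ 3 \<le> 32 * (real k)\<^sup>2 * (5 * real L) ^ 6"
      using Q_pos by simp
    \<comment> \<open>Enlarging 32 to 64 makes the right side a perfect cube.\<close>
    also have "\<dots> \<le> 64 * (real k)\<^sup>2 * (5 * real L) ^ 6"
      by (intro mult_right_mono) auto
    also have "\<dots> = (4 * (real q)\<^sup>2 * (5 * real L)\<^sup>2) ^ 3"
      by (simp add: k_def power_mult_distrib flip: power_mult)
    finally have "Q \<le> 4 * (real q)\<^sup>2 * (5 * real L)\<^sup>2"
      by (rule power_le_imp_le_base[of _ 2, simplified]) simp
    then show ?thesis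
      using V2 by (simp add: power_mult_distrib add_increasing)
  qed
  then show ?thesis
    by (simp add: V_def k_def p_def)
qed

text \<open>The bound \<open>L\<close> covers the visits still to come as well as \<open>A\<close>,
  so it survives when the sites of a finished window join the visited set.\<close>

lemma mean_time_windows_le:
  fixes q L b j :: nat
  assumes "b > 0" "finite A" and "\<And>y. card {a. (a, y) \<in> A} + card {i. i < j * q ^ 3 \<and> lev i = y} \<le> L"
    and "\<And>w y. w < j \<Longrightarrow> card {i. i < q ^ 3 \<and> lev (w * q ^ 3 + i) = y} \<le> b"
  shows "mean_time (j * q ^ 3) lev (A, x) \<le> real j * (real q ^ 3 + 2 * real q ^ 3 * (real b)\<^sup>2 + 200 * (real q)\<^sup>2 * (real L)\<^sup>2)"
  using assms(2-4)
proof (induction j arbitrary: A x lev)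
  case 0
  then show ?case
    by simp
next
  case (Suc j)
  let ?W = "real q ^ 3 + 2 * real q ^ 3 * (real b)\<^sup>2 + 200 * (real q)\<^sup>2 * (real L)\<^sup>2"
  have row: "card {a. (a, y) \<in> A} \<le> L" for y
    using Suc.prems(2)[of y] by simp
  have "E (law lev (A, x) (q ^ 3)) (mean_time (j * q ^ 3) (\<lambda>i. lev (q ^ 3 + i))) \<le>
      E (law lev (A, x) (q ^ 3)) (\<lambda>_. real j * ?W)"
  proof (rule E_mono)
    fix \<sigma> assume \<sigma>: "\<sigma> \<in> set_pmf (law lev (A, x) (q ^ 3))"
    have "card {a. (a, y) \<in> fst \<sigma>} + card {i. i < j * q ^ 3 \<and> lev (q ^ 3 + i) = y} \<le> L" for y
    proof -
      have "{i. i < Suc j * q ^ 3 \<and> lev i = y} =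
          {i. i < q ^ 3 \<and> lev i = y} \<union> (\<lambda>i. q ^ 3 + i) ` {i. i < j * q ^ 3 \<and> lev (q ^ 3 + i) = y}"
        by (auto simp: image_iff) (metis add_diff_inverse_nat add_less_cancel_left less_or_eq_imp_le linorder_not_less)
      moreover have "card \<dots> = card {i. i < q ^ 3 \<and> lev i = y} + card {i. i < j * q ^ 3 \<and> lev (q ^ 3 + i) = y}"
        by (subst card_Un_disjoint) (auto simp: card_image)
      ultimately show ?thesis
        using law_props(3)[OF Suc.prems(1) \<sigma>, of y] Suc.prems(2)[of y] by simp
    qed
    moreover have "card {i. i < q ^ 3 \<and> lev (q ^ 3 + (w * q ^ 3 + i)) = y} \<le> b" if "w < j" for w y
      using Suc.prems(3)[of "Suc w" y] that by (simp add: add.assoc)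
    ultimately show "mean_time (j * q ^ 3) (\<lambda>i. lev (q ^ 3 + i)) \<sigma> \<le> real j * ?W"
      using Suc.IH[of "fst \<sigma>" "\<lambda>i. lev (q ^ 3 + i)" "snd \<sigma>"] law_props(1)[OF Suc.prems(1) \<sigma>] by simp
  qed
  also have "\<dots> = real j * ?W"
    by (rule E_const[OF finite_law])
  finally have rest: "E (law lev (A, x) (q ^ 3)) (mean_time (j * q ^ 3) (\<lambda>i. lev (q ^ 3 + i))) \<le> real j * ?W" .
  have "mean_time (Suc j * q ^ 3) lev (A, x) = (\<Sum>i<q ^ 3. 1 + E (law lev (A, x) i) (sojourn (lev i)))
     + E (law lev (A, x) (q ^ 3)) (mean_time (j * q ^ 3) (\<lambda>i. lev (q ^ 3 + i)))"
    unfolding mult_Suc by (rule mean_time_add[OF Suc.prems(1)])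
  also have "(\<Sum>i<q ^ 3. 1 + E (law lev (A, x) i) (sojourn (lev i))) \<le> ?W"
    using window_sojourn_le[OF Suc.prems(1) assms(1) row, of q lev x] Suc.prems(3)[of 0]
    by (simp add: sum.distrib)
  finally show ?case
    using rest by (simp add: algebra_simps)
qed

section \<open>Comparison with the walk in single time steps\<close>

lemma exit_mean_refl [simp]: "exit_mean x x x F = F x"
  by (simp add: exit_mean_def exit_prob_def)

text \<open>From every point of the closed interval the walk exits at the same two sites, so one
  formula serves for all starting points. At an end point the interval seen from there degenerates,
  in agreement with the formula.\<close>

lemma mean_time_on_interval:
  assumes "finite A" and z: "lo A (lev 0) x \<le> z" "z \<le> hi A (lev 0) x"
  shows "mean_time (Suc k) lev (A, z) =
     1 + (real_of_int z - real_of_int (lo A (lev 0) x)) * (real_of_int (hi A (lev 0) x) - real_of_int z) +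
     exit_mean (lo A (lev 0) x) (hi A (lev 0) x) z (\<lambda>a. mean_time k (\<lambda>i. lev (Suc i)) (insert (a, lev 0) A, a))"
proof -
  define y \<alpha> \<beta> where "y = lev 0" and "\<alpha> = lo A y x" and "\<beta> = hi A y x"
  have out: "(\<alpha>, y) \<notin> A" "(\<beta>, y) \<notin> A"
    using lo_props(2) hi_props(2) assms(1) by (auto simp: \<alpha>_def \<beta>_def)
  have inside: "(a, y) \<in> A" if "\<alpha> < a" "a < \<beta>" for a
    using visited_between[OF assms(1)] that by (simp add: \<alpha>_def \<beta>_def)
  have le: "\<alpha> \<le> z" "z \<le> \<beta>"
    using z by (simp_all add: \<alpha>_def \<beta>_def y_def)
  consider "z = \<alpha>" | "z = \<beta>" "\<alpha> < \<beta>" | "\<alpha> < z" "z < \<beta>"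
    using le by linarith
  then show ?thesis
    unfolding y_def[symmetric] \<alpha>_def[symmetric] \<beta>_def[symmetric] mean_time.simps
  proof cases
    case 1
    then show "1 + sojourn y (A, z) + exit_exp y (A, z) (mean_time k (\<lambda>i. lev (Suc i))) =
      1 + (real_of_int z - real_of_int \<alpha>) * (real_of_int \<beta> - real_of_int z) +
      exit_mean \<alpha> \<beta> z (\<lambda>a. mean_time k (\<lambda>i. lev (Suc i)) (insert (a, y) A, a))"
      using lo_hi_unvisited[OF out(1) assms(1)] by (simp add: sojourn_def exit_exp_def) (simp add: exit_mean_def exit_prob_def)
  next
    case 2
    then show "1 + sojourn y (A, z) + exit_exp y (A, z) (mean_time k (\<lambda>i. lev (Suc i))) =
      1 + (real_of_int z - real_of_int \<alpha>) * (real_of_int \<beta> - real_of_int z) +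
      exit_mean \<alpha> \<beta> z (\<lambda>a. mean_time k (\<lambda>i. lev (Suc i)) (insert (a, y) A, a))"
      using lo_hi_unvisited[OF out(2) assms(1)] by (simp add: sojourn_def exit_exp_def) (simp add: exit_mean_def exit_prob_def)
  next
    case 3
    have "lo A y z = \<alpha>" "hi A y z = \<beta>"
      using 3 out inside by (auto intro!: lo_eqI hi_eqI assms(1))
    then show "1 + sojourn y (A, z) + exit_exp y (A, z) (mean_time k (\<lambda>i. lev (Suc i))) =
      1 + (real_of_int z - real_of_int \<alpha>) * (real_of_int \<beta> - real_of_int z) +
      exit_mean \<alpha> \<beta> z (\<lambda>a. mean_time k (\<lambda>i. lev (Suc i)) (insert (a, y) A, a))"
      by (simp add: sojourn_def exit_exp_def)
  qed
qed

text \<open>On the interval the mean time is a quadratic in the position plus an affine function.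
  Its second difference -2 accounts for the one unit of time, which ties the exit formulas to single
  horizontal steps.\<close>

lemma mean_time_visited:
  assumes "finite A" and "(x, lev 0) \<in> A"
  shows "mean_time (Suc k) lev (A, x) = 1 + (mean_time (Suc k) lev (A, x + 1) + mean_time (Suc k) lev (A, x - 1)) / 2"
proof -
  define \<alpha> \<beta> where "\<alpha> = lo A (lev 0) x" and "\<beta> = hi A (lev 0) x"
  define H where "H a = mean_time k (\<lambda>i. lev (Suc i)) (insert (a, lev 0) A, a)" for a
  define p where "p = exit_prob \<alpha> \<beta>"
  have "\<alpha> \<noteq> x" "\<beta> \<noteq> x"
    unfolding \<alpha>_def \<beta>_def using lo_props(2)[OF assms(1)] hi_props(2)[OF assms(1)] assms(2) by metis+
  then have lt: "\<alpha> < x" "x < \<beta>"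
    using lo_props(1)[OF assms(1)] hi_props(1)[OF assms(1)] by (auto simp: \<alpha>_def \<beta>_def order.strict_iff_order)
  have mt: "mean_time (Suc k) lev (A, z) = 1 + (real_of_int z - real_of_int \<alpha>) * (real_of_int \<beta> - real_of_int z) +
      ((1 - p z) * H \<alpha> + p z * H \<beta>)" if "\<alpha> \<le> z" "z \<le> \<beta>" for z
    using mean_time_on_interval[where x = x and z = z and lev = lev and k = k, OF assms(1)] that
    by (simp only: \<alpha>_def \<beta>_def p_def H_def exit_mean_def)
  have "p (x + 1) + p (x - 1) = 2 * p x"
    unfolding p_def exit_prob_def add_divide_distrib[symmetric] by simp
  then have p: "p (x - 1) = 2 * p x - p (x + 1)"
    by linarith
  show ?thesis
    using lt by (subst (1 2 3) mt) (auto simp: p algebra_simps field_simps)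
qed

text \<open>The probability that the walk with vertical trajectory \<open>lev\<close> makes fewer than \<open>k\<close> vertical steps within time \<open>n\<close>.\<close>

fun late :: "nat \<Rightarrow> nat \<Rightarrow> (nat \<Rightarrow> int) \<Rightarrow> (int \<times> int) set \<Rightarrow> int \<Rightarrow> real" where
  "late 0 k lev A x = of_bool (k > 0)"
| "late (Suc n) 0 lev A x = 0"
| "late (Suc n) (Suc k) lev A x =
     (if (x, lev 0) \<in> A then (late n (Suc k) lev A (x + 1) + late n (Suc k) lev A (x - 1)) / 2
      else late n k (\<lambda>i. lev (Suc i)) (insert (x, lev 0) A) x)"

lemma late_le_1: "late n k lev A x \<le> 1"
proof (induction n k lev A x rule: late.induct)
  case (3 n k lev A x)
  then show ?case
    by (cases "(x, lev 0) \<in> A") simp_all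
qed simp_all

text \<open>Markov's inequality for the time of the \<open>k\<close>-th vertical step. In the
  induction each time step adds at most one to the left side, as \<open>late\<close> is at most
  1.\<close>

lemma late_le_mean_time:
  assumes "finite A"
  shows "real n * late n k lev A x \<le> mean_time k lev (A, x)"
  using assms
proof (induction n k lev A x rule: late.induct)
  case (1 k lev A x)
  have "0 \<le> mean_time k lev (A, x)"
    using 1
  proof (induction k arbitrary: lev A x)
    case (Suc k)
    have le: "lo A (lev 0) x \<le> x" "x \<le> hi A (lev 0) x"
      using Suc.prems lo_props(1) hi_props(1) by auto
    have "0 \<le> exit_exp (lev 0) (A, x) (mean_time k (\<lambda>i. lev (Suc i)))"
      using exit_mean_mono[OF le, of "\<lambda>_. 0" "\<lambda>a. mean_time k (\<lambda>i. lev (Suc i)) (insert (a, lev 0) A, a)"] Suc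
      by (simp add: exit_exp_def)
    moreover have "0 \<le> sojourn (lev 0) (A, x)"
      using le by (simp add: sojourn_def)
    ultimately show ?case
      by simp
  qed simp
  then show ?case
    by simp
next
  case (3 n k lev A x)
  show ?case
  proof (cases "(x, lev 0) \<in> A")
    case True
    have "real (Suc n) * late (Suc n) (Suc k) lev A x =
        (real n * late n (Suc k) lev A (x + 1) + real n * late n (Suc k) lev A (x - 1)) / 2 +
        (late n (Suc k) lev A (x + 1) + late n (Suc k) lev A (x - 1)) / 2"
      using True by (simp add: field_simps)
    also have "\<dots> \<le> (mean_time (Suc k) lev (A, x + 1) + mean_time (Suc k) lev (A, x - 1)) / 2 + 1"
      using 3 True late_le_1[of n "Suc k" lev A "x + 1"] late_le_1[of n "Suc k" lev A "x - 1"]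
      by (intro add_mono divide_right_mono) auto
    also have "\<dots> = mean_time (Suc k) lev (A, x)"
      using mean_time_visited[where A = A and x = x and lev = lev, OF 3(4) True] by simp
    finally show ?thesis .
  next
    case False
    have "real n * late n k (\<lambda>i. lev (Suc i)) (insert (x, lev 0) A) x \<le> mean_time k (\<lambda>i. lev (Suc i)) (insert (x, lev 0) A, x)"
      using 3 False by simp
    then show ?thesis
      using False late_le_1[of n k "\<lambda>i. lev (Suc i)" "insert (x, lev 0) A" x] lo_hi_unvisited[OF False 3(4)]
      by (simp add: sojourn_def exit_exp_def algebra_simps)
  qed
qed simp

section \<open>Averaging over the vertical trajectory\<close>

primrec avg :: "nat \<Rightarrow> (int list \<Rightarrow> real) \<Rightarrow> real" where
  "avg 0 f = f []"
| "avg (Suc k) f = (avg k (\<lambda>vs. f (1 # vs)) + avg k (\<lambda>vs. f (- 1 # vs))) / 2"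

lemma avg_add: "avg k (\<lambda>vs. f vs + g vs) = avg k f + avg k g"
  by (induction k arbitrary: f g) (simp_all add: field_simps)

lemma avg_mult: "avg k (\<lambda>vs. c * f vs) = c * avg k f"
  by (induction k arbitrary: f) (simp_all add: field_simps)

lemma avg_const [simp]: "avg k (\<lambda>_. c) = c"
  by (induction k) simp_all

lemma avg_sum: "avg k (\<lambda>vs. \<Sum>i\<in>I. f i vs) = (\<Sum>i\<in>I. avg k (f i))"
  by (induction k arbitrary: f) (simp_all add: sum.distrib flip: sum_divide_distrib)

lemma avg_mono:
  assumes "\<And>vs. length vs = k \<Longrightarrow> set vs \<subseteq> {1, -1} \<Longrightarrow> f vs \<le> g vs"
  shows "avg k f \<le> avg k g"
  using assms
proof (induction k arbitrary: f g)
  case (Suc k)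
  have "avg k (\<lambda>vs. f (v # vs)) \<le> avg k (\<lambda>vs. g (v # vs))" if "v \<in> {1, -1}" for v
    using that by (intro Suc.IH Suc.prems) auto
  from this[of 1] this[of "-1"] show ?case
    by simp
qed simp

lemma avg_drop: "avg (a + m) (\<lambda>vs. f (drop a vs)) = avg m f"
  by (induction a) simp_all

lemma avg_take: "avg (s + c) (\<lambda>vs. f (take s vs)) = avg s f"
proof (induction s arbitrary: f)
  case (Suc s)
  show ?case
    using Suc.IH[of "\<lambda>vs. f (1 # vs)"] Suc.IH[of "\<lambda>vs. f (- 1 # vs)"] by simp
qed simp

definition levels :: "int \<Rightarrow> int list \<Rightarrow> nat \<Rightarrow> int" where
  "levels y vs i = y + sum_list (take i vs)"

lemma levels_0 [simp]: "levels y vs 0 = y"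
  by (simp add: levels_def)

lemma levels_Cons_Suc [simp]: "levels y (v # vs) (Suc i) = levels (y + v) vs i"
  by (simp add: levels_def)

text \<open>The signs of the vertical steps can be drawn in advance: a departure from a site outside
  \<open>A\<close> adds that site and uses up exactly one sign.\<close>

lemma prob_few_sites_le_avg:
  assumes "finite A"
  shows "measure_pmf.prob (walk n A (x, y)) {xs. card (A \<union> set xs) < card A + k}
     \<le> avg k (\<lambda>vs. late n k (levels y vs) A x)"
  using assms
proof (induction n arbitrary: k A x y)
  case 0
  \<comment> \<open>The last site is counted before it is departed from, so only an inequality
    holds.\<close>
  have "card A \<le> card (insert (x, y) A)"
    using 0 by (intro card_mono) auto
  then show ?case
    by (cases k) simp_all
next
  case (Suc n)
  show ?case
  proof (cases k)
    case 0
    have "\<not> card (A \<union> set xs) < card A + k" for xs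
      using Suc.prems 0 card_mono[of "A \<union> set xs" A] by (simp add: not_less)
    then show ?thesis
      using 0 by (simp del: walk.simps)
  next
    case (Suc k')
    show ?thesis
    proof (cases "(x, y) \<in> A")
      case True
      then have A: "insert (x, y) A = A"
        by auto
      have un: "A \<union> set ((x, y) # xs) = A \<union> set xs" for xs
        using True by auto
      have "measure_pmf.prob (walk (Suc n) A (x, y)) {xs. card (A \<union> set xs) < card A + k} =
          (measure_pmf.prob (walk n A (x + 1, y)) {xs. card (A \<union> set xs) < card A + k} +
           measure_pmf.prob (walk n A (x - 1, y)) {xs. card (A \<union> set xs) < card A + k}) / 2"
        unfolding prob_walk_Suc A un using True by (simp add: dir_def)
      also have "\<dots> \<le> (avg k (\<lambda>vs. late n k (levels y vs) A (x + 1)) + avg k (\<lambda>vs. late n k (levels y vs) A (x - 1))) / 2"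
        using Suc.IH[OF Suc.prems] by (intro divide_right_mono add_mono) auto
      also have "\<dots> = avg k (\<lambda>vs. (1 / 2) * (late n k (levels y vs) A (x + 1) + late n k (levels y vs) A (x - 1)))"
        unfolding avg_mult avg_add by simp
      also have "\<dots> = avg k (\<lambda>vs. late (Suc n) k (levels y vs) A x)"
        unfolding Suc late.simps levels_0 using True by simp
      finally show ?thesis .
    next
      case False
      have card: "card (insert (x, y) A) = Suc (card A)"
        using False Suc.prems by simp
      have "measure_pmf.prob (walk (Suc n) A (x, y)) {xs. card (A \<union> set xs) < card A + k} =
          (measure_pmf.prob (walk n (insert (x, y) A) (x, y + 1)) {xs. card (insert (x, y) A \<union> set xs) < card (insert (x, y) A) + k'} +
           measure_pmf.prob (walk n (insert (x, y) A) (x, y + (- 1))) {xs. card (insert (x, y) A \<union> set xs) < card (insert (x, y) A) + k'}) / 2"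
        unfolding prob_walk_Suc card Suc using False by (simp add: dir_def)
      also have "\<dots> \<le> (avg k' (\<lambda>vs. late n k' (levels (y + 1) vs) (insert (x, y) A) x) +
           avg k' (\<lambda>vs. late n k' (levels (y + (- 1)) vs) (insert (x, y) A) x)) / 2"
        using Suc.prems by (intro divide_right_mono add_mono Suc.IH) auto
      also have "\<dots> = avg k (\<lambda>vs. late (Suc n) k (levels y vs) A x)"
        unfolding Suc avg.simps late.simps levels_0 using False by (simp del: add_uminus_conv_diff)
      finally show ?thesis .
    qed
  qed
qed

section \<open>Visits of the vertical walk to a level\<close>

definition visits :: "int \<Rightarrow> int list \<Rightarrow> int \<Rightarrow> nat" where
  "visits y vs z = card {i. i < length vs \<and> levels y vs i = z}"

lemma visits_Nil [simp]: "visits y [] z = 0"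
  by (simp add: visits_def)

lemma visits_Cons: "visits y (v # vs) z = of_bool (y = z) + visits (y + v) vs z"
proof -
  have "{i. i < length (v # vs) \<and> levels y (v # vs) i = z} =
      (if y = z then {0} else {}) \<union> Suc ` {i. i < length vs \<and> levels (y + v) vs i = z}"
    by (auto simp: image_iff less_Suc_eq_0_disj split: if_splits)
  then show ?thesis
    unfolding visits_def by (simp only:) (subst card_Un_disjoint, auto simp: card_image)
qed

text \<open>Tanaka's formula: visits minus distance is a martingale. Away from \<open>z\<close> its
  increments are \<plusminus>1 and give a factor \<open>cosh l\<close>; at \<open>z\<close> the
  visit and the growth of the distance cancel.\<close>

lemma avg_exp_visits_le:
  fixes l :: real
  assumes "0 \<le> l"
  shows "avg k (\<lambda>vs. exp (l * (real (visits y vs z) - real_of_int \<bar>y + sum_list vs - z\<bar>)))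
     \<le> cosh l ^ k * exp (- l * real_of_int \<bar>y - z\<bar>)"
proof (induction k arbitrary: y)
  case (Suc k)
  let ?f = "\<lambda>y vs. exp (l * (real (visits y vs z) - real_of_int \<bar>y + sum_list vs - z\<bar>))"
  let ?e = "\<lambda>y. exp (- l * real_of_int \<bar>y - z\<bar>)"
  have step: "?f y (v # vs) = exp (l * of_bool (y = z)) * ?f (y + v) vs" for v vs
    by (simp add: visits_Cons add.assoc distrib_left right_diff_distrib flip: exp_add)
  have "avg (Suc k) (?f y) = exp (l * of_bool (y = z)) * ((avg k (?f (y + 1)) + avg k (?f (y + - 1))) / 2)"
    unfolding avg.simps step avg_mult by (simp only: distrib_left times_divide_eq_right)
  also have "\<dots> \<le> exp (l * of_bool (y = z)) * ((cosh l ^ k * ?e (y + 1) + cosh l ^ k * ?e (y + - 1)) / 2)"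
    by (intro mult_left_mono divide_right_mono add_mono Suc.IH) auto
  also have "\<dots> = cosh l ^ k * (exp (l * of_bool (y = z)) * ((?e (y + 1) + ?e (y + - 1)) / 2))"
    by (simp add: algebra_simps)
  also have "\<dots> \<le> cosh l ^ k * (cosh l * ?e y)"
  proof (intro mult_left_mono)
    consider "y = z" | "z < y" | "y < z"
      by linarith
    then show "exp (l * of_bool (y = z)) * ((?e (y + 1) + ?e (y + - 1)) / 2) \<le> cosh l * ?e y"
    proof cases
      case 1
      then show ?thesis
        using cosh_real_ge_1[of l] by (simp flip: exp_add)
    next
      case 2
      then have "real_of_int \<bar>y + 1 - z\<bar> = real_of_int \<bar>y - z\<bar> + 1" "real_of_int \<bar>y + - 1 - z\<bar> = real_of_int \<bar>y - z\<bar> - 1"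
        by auto
      then show ?thesis
        using 2 by (simp only: cosh_field_def) (simp add: algebra_simps exp_add exp_diff exp_minus field_simps)
    next
      case 3
      then have "real_of_int \<bar>y + 1 - z\<bar> = real_of_int \<bar>y - z\<bar> - 1" "real_of_int \<bar>y + - 1 - z\<bar> = real_of_int \<bar>y - z\<bar> + 1"
        by auto
      then show ?thesis
        using 3 by (simp only: cosh_field_def) (simp add: algebra_simps exp_add exp_diff exp_minus field_simps)
    qed
  qed (simp add: cosh_real_nonneg)
  finally show ?case
    by (simp add: mult_ac)
qed simp

lemma avg_exp_sum: "avg k (\<lambda>vs. exp (l * real_of_int (sum_list vs))) = cosh l ^ k"
proof (induction k)
  case (Suc k)
  have "exp (l * real_of_int (sum_list (v # vs))) = exp (l * real_of_int v) * exp (l * real_of_int (sum_list vs))" for v vs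
    by (simp add: distrib_left flip: exp_add)
  then show ?case
    by (simp only: avg.simps avg_mult Suc.IH) (simp add: cosh_field_def field_simps)
qed simp

text \<open>With \<open>m\<close> visits, either the total displacement is at least
  \<open>m / 2\<close> in absolute value or the martingale of \<open>avg_exp_visits_le\<close> has
  grown by \<open>m / 2\<close>. Chernoff bounds for these three events give the factor 3.\<close>

lemma avg_visits_ge_le:
  fixes l m :: real
  assumes "0 \<le> l"
  shows "avg k (\<lambda>vs. of_bool (m \<le> real (visits y vs z))) \<le> 3 * (cosh l ^ k * exp (- l * (m / 2)))"
proof -
  let ?d = "real_of_int \<bar>y - z\<bar>"
  define c where "c = exp (- l * (m / 2))"
  have "avg k (\<lambda>vs. of_bool (m \<le> real (visits y vs z))) \<le>
    avg k (\<lambda>vs. (c * exp (l * ?d)) * exp (l * (real (visits y vs z) - real_of_int \<bar>y + sum_list vs - z\<bar>)) +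
      (c * exp (l * real_of_int (sum_list vs)) + c * exp (- l * real_of_int (sum_list vs))))"
  proof (rule avg_mono)
    fix vs
    define S X where "S = real_of_int (sum_list vs)" and "X = real (visits y vs z) - real_of_int \<bar>y + sum_list vs - z\<bar>"
    have pos: "0 \<le> c * exp t" for t
      by (simp add: c_def)
    have ge1: "1 \<le> c * exp (l * t)" if "t \<ge> m / 2" for t
    proof -
      have "l * (m / 2) \<le> l * t"
        using that assms by (rule mult_left_mono)
      then show ?thesis
        by (simp add: c_def flip: exp_add)
    qed
    consider "S \<ge> m / 2" | "- S \<ge> m / 2" | "\<bar>S\<bar> < m / 2"
      by linarith
    then have "of_bool (m \<le> real (visits y vs z)) \<le> c * exp (l * (?d + X)) + (c * exp (l * S) + c * exp (l * (- S)))"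
    proof cases
      case 1
      then show ?thesis
        using ge1[of S] pos[of "l * (?d + X)"] pos[of "l * (- S)"] by simp
    next
      case 2
      then show ?thesis
        using ge1[of "- S"] pos[of "l * (?d + X)"] pos[of "l * S"] by simp
    next
      case 3
      show ?thesis
      proof (cases "m \<le> real (visits y vs z)")
        case True
        have "real_of_int \<bar>y + sum_list vs - z\<bar> \<le> ?d + \<bar>S\<bar>"
          unfolding S_def by linarith
        then have "?d + X \<ge> m / 2"
          using True 3 unfolding X_def by linarith
        then show ?thesis
          using ge1[of "?d + X"] pos[of "l * S"] pos[of "l * (- S)"] by simp
      next
        case False
        then show ?thesis
          using pos[of "l * (?d + X)"] pos[of "l * S"] pos[of "l * (- S)"] by simp
      qed
    qed
    then show "of_bool (m \<le> real (visits y vs z)) \<le> (c * exp (l * ?d)) * exp (l * X) +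
      (c * exp (l * S) + c * exp (- l * S))"
      by (simp add: distrib_left exp_add mult.assoc)
  qed
  also have "\<dots> \<le> (c * exp (l * ?d)) * (cosh l ^ k * exp (- l * ?d)) + (c * cosh l ^ k + c * cosh (- l) ^ k)"
    unfolding avg_add avg_mult using avg_exp_visits_le[OF assms, of k y z] avg_exp_sum[of k l] avg_exp_sum[of k "- l"]
    by (intro add_mono mult_left_mono) (auto simp: c_def)
  also have "\<dots> = 3 * (cosh l ^ k * c)"
    by (simp add: exp_minus)
  finally show ?thesis
    by (simp add: c_def)
qed

lemma cosh_le_exp_square:
  fixes l :: real
  assumes "0 \<le> l" "l \<le> 1"
  shows "cosh l \<le> exp (l\<^sup>2)"
proof -
  have "exp (- l) \<le> 1 - l + l\<^sup>2"
  proof -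
    have "1 \<le> (1 - l + l\<^sup>2) * (1 + l)"
      using assms by (simp add: power2_eq_square algebra_simps)
    also have "\<dots> \<le> (1 - l + l\<^sup>2) * exp l"
      using assms exp_ge_add_one_self[of l] by (intro mult_left_mono) (auto intro: add_nonneg_nonneg)
    finally show ?thesis
      by (simp add: exp_minus field_simps)
  qed
  then have "cosh l \<le> 1 + l\<^sup>2"
    using exp_bound[OF assms] by (simp add: cosh_field_def)
  then show ?thesis
    using exp_ge_add_one_self[of "l\<^sup>2"] by linarith
qed

text \<open>With \<open>l = 1 / sqrt k\<close> the factor \<open>cosh l ^ k\<close> is at most 3,
  hence 9 for a single level. The union bound runs over the \<open>2 * k - 1\<close> levels that can
  be reached.\<close>

lemma avg_max_visits_le:
  assumes "k > 0" and "\<Lambda> \<ge> 0" and m: "real m \<ge> 2 * sqrt (real k) * \<Lambda>"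
  shows "avg k (\<lambda>vs. of_bool (\<exists>z. m < visits 0 vs z)) \<le> 27 * real k * exp (- \<Lambda>)"
proof -
  define l where "l = 1 / sqrt (real k)"
  have l: "0 \<le> l" "l \<le> 1"
    using assms(1) by (auto simp: l_def)
  have "cosh l ^ k \<le> exp (l\<^sup>2) ^ k"
    using cosh_le_exp_square[OF l] by (intro power_mono) auto
  also have "\<dots> = exp 1"
    using assms(1) by (simp add: l_def power_divide flip: exp_of_nat_mult)
  also have "\<dots> \<le> 3"
    by (rule exp_le)
  finally have cosh: "cosh l ^ k \<le> 3" .
  have "\<Lambda> \<le> l * (real m / 2)"
    using m assms(1) by (simp add: l_def field_simps)
  then have exp: "exp (- l * (real m / 2)) \<le> exp (- \<Lambda>)"
    by simp
  have single: "avg k (\<lambda>vs. of_bool (real m \<le> real (visits 0 vs z))) \<le> 9 * exp (- \<Lambda>)" for z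
  proof -
    have "avg k (\<lambda>vs. of_bool (real m \<le> real (visits 0 vs z))) \<le> 3 * (cosh l ^ k * exp (- l * (real m / 2)))"
      by (rule avg_visits_ge_le[OF l(1)])
    also have "\<dots> \<le> 3 * (3 * exp (- \<Lambda>))"
      using cosh exp by (intro mult_left_mono mult_mono) auto
    finally show ?thesis
      by simp
  qed
  have "avg k (\<lambda>vs. of_bool (\<exists>z. m < visits 0 vs z)) \<le> avg k (\<lambda>vs. \<Sum>z\<in>{-(int k - 1)..int k - 1}. of_bool (real m \<le> real (visits 0 vs z)))"
  proof (rule avg_mono)
    fix vs :: "int list" assume len: "length vs = k" and vs: "set vs \<subseteq> {1, -1}"
    show "of_bool (\<exists>z. m < visits 0 vs z) \<le> (\<Sum>z\<in>{-(int k - 1)..int k - 1}. of_bool (real m \<le> real (visits 0 vs z)) :: real)"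
    proof (cases "\<exists>z. m < visits 0 vs z")
      case True
      then obtain z where z: "m < visits 0 vs z"
        by auto
      then have "visits 0 vs z > 0"
        by simp
      then obtain i where i: "i < k" "levels 0 vs i = z"
        unfolding visits_def len by (auto simp: card_gt_0_iff)
      have "\<bar>sum_list (take i vs)\<bar> \<le> int (length (take i vs))"
      proof -
        have "\<bar>sum_list us\<bar> \<le> int (length us)" if "set us \<subseteq> {1, -1}" for us :: "int list"
          using that by (induction us) auto
        moreover have "set (take i vs) \<subseteq> {1, -1}"
          using vs set_take_subset by fast
        ultimately show ?thesis .
      qed
      then have "z \<in> {-(int k - 1)..int k - 1}"
        using i len by (auto simp: levels_def)
      then have "(\<Sum>z\<in>{z}. of_bool (real m \<le> real (visits 0 vs z)) :: real) \<le> (\<Sum>z\<in>{-(int k - 1)..int k - 1}. of_bool (real m \<le> real (visits 0 vs z)))"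
        by (intro sum_mono2) auto
      then show ?thesis
        using z by simp
    qed (simp add: sum_nonneg)
  qed
  also have "\<dots> \<le> real (card {-(int k - 1)..int k - 1}) * (9 * exp (- \<Lambda>))"
    unfolding avg_sum using single by (intro sum_bounded_above) auto
  also have "\<dots> \<le> (3 * real k) * (9 * exp (- \<Lambda>))"
    using assms(1) by (intro mult_right_mono) auto
  finally show ?thesis
    by simp
qed

text \<open>The first term bounds the chance that some level is visited too often, in the whole
  trajectory or within one of the \<open>q\<close> windows; these two kinds contribute equally.
  Otherwise Markov's inequality and the mean duration give the second term.\<close>

lemma prob_few_sites_le:
  assumes "q > 0" "n > 0" "\<Lambda> \<ge> 1"
  shows "measure_pmf.prob (walk n {} (0, 0)) {xs. card (set xs) < q ^ 4}
     \<le> 54 * real q ^ 4 * exp (- \<Lambda>) + 2000 * real q ^ 7 * \<Lambda>\<^sup>2 / real n"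
proof -
  define k s where "k = q * q ^ 3" and "s = q ^ 3"
  define L b where "L = nat \<lceil>2 * sqrt (real k) * \<Lambda>\<rceil>" and "b = nat \<lceil>2 * sqrt (real s) * \<Lambda>\<rceil>"
  define bad where "bad vs \<longleftrightarrow> (\<exists>z. L < visits 0 vs z) \<or> (\<exists>w<q. \<exists>z. b < visits 0 (take s (drop (w * s) vs)) z)" for vs
  have "k > 0" "s > 0"
    using assms by (simp_all add: k_def s_def)
  then have ge1: "sqrt (real k) * \<Lambda> \<ge> 1 * 1" "sqrt (real s) * \<Lambda> \<ge> 1 * 1"
    using assms(3) by (intro mult_mono; simp)+
  have L: "2 * sqrt (real k) * \<Lambda> \<le> real L" "real L \<le> 3 * (sqrt (real k) * \<Lambda>)"
    and b: "2 * sqrt (real s) * \<Lambda> \<le> real b" "real b \<le> 3 * (sqrt (real s) * \<Lambda>)"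
    using ge1 unfolding L_def b_def by linarith+
  have L2: "(real L)\<^sup>2 \<le> 9 * (real q ^ 4 * \<Lambda>\<^sup>2)"
  proof -
    have "(real L)\<^sup>2 \<le> (3 * (sqrt (real k) * \<Lambda>))\<^sup>2"
      using L(2) by (intro power_mono) auto
    moreover have "real k = real q ^ 4"
      by (simp add: k_def power_numeral_reduce)
    ultimately show ?thesis
      by (simp add: power_mult_distrib)
  qed
  have b2: "(real b)\<^sup>2 \<le> 9 * (real q ^ 3 * \<Lambda>\<^sup>2)"
  proof -
    have "(real b)\<^sup>2 \<le> (3 * (sqrt (real s) * \<Lambda>))\<^sup>2"
      using b(2) by (intro power_mono) auto
    then show ?thesis
      by (simp add: power_mult_distrib s_def)
  qed
  have good: "late n k (levels 0 vs) {} 0 \<le> 2000 * real q ^ 7 * \<Lambda>\<^sup>2 / real n"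
    if "\<not> bad vs" and len: "length vs = k" for vs
  proof -
    have "mean_time (q * q ^ 3) (levels 0 vs) ({}, 0) \<le>
       real q * (real q ^ 3 + 2 * real q ^ 3 * (real b)\<^sup>2 + 200 * (real q)\<^sup>2 * (real L)\<^sup>2)"
    proof (rule mean_time_windows_le)
      show "b > 0"
        using b(1) ge1(2) by linarith
      show "card {a. (a, y) \<in> {}} + card {i. i < q * q ^ 3 \<and> levels 0 vs i = y} \<le> L" for y :: int
        using that by (simp add: bad_def visits_def k_def not_less)
      fix w y assume w: "w < q"
      define us where "us = take s (drop (w * s) vs)"
      have "Suc w * s \<le> q * s"
        using w by (intro mult_right_mono) auto
      then have us: "length us = s"
        using len by (simp add: us_def k_def s_def)
      \<comment> \<open>Visits are counted for trajectories from level 0; a window sees the same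
        counts shifted by its starting level.\<close>
      have "levels 0 vs (w * s + i) = levels 0 vs (w * s) + levels 0 us i" if "i < s" for i
        using that by (simp add: levels_def us_def take_add min_def)
      then have "{i. i < s \<and> levels 0 vs (w * s + i) = y} = {i. i < length us \<and> levels 0 us i = y - levels 0 vs (w * s)}"
        unfolding us by auto
      then have "card {i. i < s \<and> levels 0 vs (w * s + i) = y} = visits 0 us (y - levels 0 vs (w * s))"
        by (simp add: visits_def)
      also have "\<not> b < visits 0 us (y - levels 0 vs (w * s))"
        using that(1) w unfolding bad_def us_def by blast
      then have "visits 0 us (y - levels 0 vs (w * s)) \<le> b"
        by simp
      finally show "card {i. i < q ^ 3 \<and> levels 0 vs (w * q ^ 3 + i) = y} \<le> b"
        by (simp add: s_def)
    qed simp
    \<comment> \<open>With \<open>b^2\<close> of order \<open>q^3\<close> and \<open>L^2\<close> of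
      order \<open>q^4\<close>, the short and the long intervals balance at \<open>q^6\<close> per
      window.\<close>
    also have "\<dots> \<le> real q * (real q ^ 6 * \<Lambda>\<^sup>2 + 2 * real q ^ 3 * (9 * (real q ^ 3 * \<Lambda>\<^sup>2)) + 200 * (real q)\<^sup>2 * (9 * (real q ^ 4 * \<Lambda>\<^sup>2)))"
    proof (intro mult_left_mono add_mono L2 b2)
      have "real q ^ 3 * 1 \<le> real q ^ 6 * \<Lambda>\<^sup>2"
        using assms by (intro mult_mono power_increasing) auto
      then show "real q ^ 3 \<le> real q ^ 6 * \<Lambda>\<^sup>2"
        by simp
    qed auto
    also have "\<dots> = 1819 * real q ^ 7 * \<Lambda>\<^sup>2"
      by (simp add: algebra_simps power_numeral_reduce)
    also have "\<dots> \<le> 2000 * real q ^ 7 * \<Lambda>\<^sup>2"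
      by (intro mult_right_mono) auto
    finally have "real n * late n k (levels 0 vs) {} 0 \<le> 2000 * real q ^ 7 * \<Lambda>\<^sup>2"
      using late_le_mean_time[of "{}" n k "levels 0 vs" 0] by (simp add: k_def)
    then show ?thesis
      using assms(2) by (simp add: field_simps)
  qed
  have "measure_pmf.prob (walk n {} (0, 0)) {xs. card (set xs) < q ^ 4} \<le> avg k (\<lambda>vs. late n k (levels 0 vs) {} 0)"
    using prob_few_sites_le_avg[of "{}" n 0 0 k] by (simp add: k_def power_numeral_reduce)
  also have "\<dots> \<le> avg k (\<lambda>vs. (of_bool (\<exists>z. L < visits 0 vs z) +
      (\<Sum>w<q. of_bool (\<exists>z. b < visits 0 (take s (drop (w * s) vs)) z))) + 2000 * real q ^ 7 * \<Lambda>\<^sup>2 / real n)"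
  proof (rule avg_mono)
    fix vs :: "int list" assume len: "length vs = k"
    let ?S = "\<Sum>w<q. of_bool (\<exists>z. b < visits 0 (take s (drop (w * s) vs)) z) :: real"
    have nonneg: "0 \<le> ?S" "0 \<le> 2000 * real q ^ 7 * \<Lambda>\<^sup>2 / real n"
      by (auto intro: sum_nonneg)
    show "late n k (levels 0 vs) {} 0 \<le> (of_bool (\<exists>z. L < visits 0 vs z) + ?S) + 2000 * real q ^ 7 * \<Lambda>\<^sup>2 / real n"
    proof (cases "bad vs")
      case False
      have "0 \<le> (of_bool (\<exists>z. L < visits 0 vs z) :: real)"
        by simp
      then show ?thesis
        using good[OF False len] nonneg by linarith
    next
      case True
      have "1 \<le> of_bool (\<exists>z. L < visits 0 vs z) + ?S"
      proof (cases "\<exists>z. L < visits 0 vs z")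
        case True
        then show ?thesis
          using nonneg(1) by simp
      next
        case False
        then obtain w where w: "w < q" "\<exists>z. b < visits 0 (take s (drop (w * s) vs)) z"
          using \<open>bad vs\<close> by (auto simp: bad_def)
        have "(\<Sum>w\<in>{w}. of_bool (\<exists>z. b < visits 0 (take s (drop (w * s) vs)) z) :: real) \<le> ?S"
          using w by (intro sum_mono2) auto
        then show ?thesis
          using w by simp
      qed
      then show ?thesis
        using late_le_1[of n k "levels 0 vs" "{}" 0] nonneg(2) by linarith
    qed
  qed
  also have "\<dots> = avg k (\<lambda>vs. of_bool (\<exists>z. L < visits 0 vs z)) +
      (\<Sum>w<q. avg k (\<lambda>vs. of_bool (\<exists>z. b < visits 0 (take s (drop (w * s) vs)) z))) + 2000 * real q ^ 7 * \<Lambda>\<^sup>2 / real n"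
    unfolding avg_add avg_sum avg_const ..
  also have "\<dots> \<le> 27 * real k * exp (- \<Lambda>) + (\<Sum>w<q. 27 * real s * exp (- \<Lambda>)) + 2000 * real q ^ 7 * \<Lambda>\<^sup>2 / real n"
  proof (intro add_mono order_refl sum_mono)
    show "avg k (\<lambda>vs. of_bool (\<exists>z. L < visits 0 vs z)) \<le> 27 * real k * exp (- \<Lambda>)"
      using assms L(1) by (intro avg_max_visits_le) (auto simp: k_def)
    fix w assume w: "w \<in> {..<q}"
    have "Suc w * s \<le> q * s"
      using w by (intro mult_right_mono) auto
    then have k: "k = w * s + (s + (k - Suc w * s))"
      by (simp add: k_def s_def)
    have "avg k (\<lambda>vs. of_bool (\<exists>z. b < visits 0 (take s (drop (w * s) vs)) z)) = avg s (\<lambda>vs. of_bool (\<exists>z. b < visits 0 vs z))"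
      by (subst k, subst avg_drop, subst avg_take) (rule refl)
    also have "\<dots> \<le> 27 * real s * exp (- \<Lambda>)"
      using assms b(1) by (intro avg_max_visits_le) (auto simp: s_def)
    finally show "avg k (\<lambda>vs. of_bool (\<exists>z. b < visits 0 (take s (drop (w * s) vs)) z)) \<le> 27 * real s * exp (- \<Lambda>)" .
  qed
  also have "\<dots> = 54 * real q ^ 4 * exp (- \<Lambda>) + 2000 * real q ^ 7 * \<Lambda>\<^sup>2 / real n"
    by (simp add: k_def s_def power_numeral_reduce)
  finally show ?thesis .
qed

section \<open>The theorem\<close>

text \<open>Choose \<Lambda> = 5 ln n and \<open>q\<close> of order
  \<open>n powr (1 / 7) / sqrt (ln n)\<close>. Then \<open>q ^ 4\<close> exceeds the threshold,
  while \<open>q ^ 7 * \<Lambda>^2 / n\<close> is of order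
  \<open>(ln n) powr (- 3 / 2)\<close>.\<close>

lemma prob_few_sites_tendsto_0:
  "(\<lambda>n. measure_pmf.prob (walk n {} (0, 0)) {xs. real (card (set xs)) < real n powr (4 / 7) / (ln (real n))\<^sup>2}) \<longlonglongrightarrow> 0"
proof (rule tendsto_sandwich[where f = "\<lambda>_. 0"])
  let ?x = "\<lambda>n. real n powr (1 / 7) / sqrt (ln (real n))"
  let ?f = "\<lambda>n. 54 * (2 * ?x n) ^ 4 * exp (- (5 * ln (real n))) + 2000 * (2 * ?x n) ^ 7 * (5 * ln (real n))\<^sup>2 / real n"
  show "?f \<longlonglongrightarrow> 0"
    by real_asymp
  have "eventually (\<lambda>n. ?x n > 1) sequentially" "eventually (\<lambda>n. ln (real n) > 1) sequentially"
    by real_asymp+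
  then show "eventually (\<lambda>n. measure_pmf.prob (walk n {} (0, 0))
      {xs. real (card (set xs)) < real n powr (4 / 7) / (ln (real n))\<^sup>2} \<le> ?f n) sequentially"
    using eventually_gt_at_top[of 0]
  proof eventually_elim
    case (elim n)
    define q where "q = nat \<lceil>?x n\<rceil>"
    have q: "?x n \<le> real q" "real q \<le> 2 * ?x n"
      using elim(1) unfolding q_def by linarith+
    have x4: "?x n ^ 4 = real n powr (4 / 7) / (ln (real n))\<^sup>2"
    proof -
      have "sqrt (ln (real n)) ^ 4 = ((sqrt (ln (real n)))\<^sup>2)\<^sup>2"
        by simp
      also have "\<dots> = (ln (real n))\<^sup>2"
        using elim(2) by simp
      finally show ?thesis
        using elim(3) by (simp add: power_divide powr_power)
    qed
    have "measure_pmf.prob (walk n {} (0, 0)) {xs. real (card (set xs)) < real n powr (4 / 7) / (ln (real n))\<^sup>2}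
       \<le> measure_pmf.prob (walk n {} (0, 0)) {xs. card (set xs) < q ^ 4}"
    proof (rule prob_walk_mono)
      fix xs :: "(int \<times> int) list"
      assume "real (card (set xs)) < real n powr (4 / 7) / (ln (real n))\<^sup>2"
      also have "\<dots> \<le> real q ^ 4"
        unfolding x4[symmetric] using q(1) elim(1) by (intro power_mono) auto
      finally show "card (set xs) < q ^ 4"
        by (simp flip: of_nat_power)
    qed
    also have "\<dots> \<le> 54 * real q ^ 4 * exp (- (5 * ln (real n))) + 2000 * real q ^ 7 * (5 * ln (real n))\<^sup>2 / real n"
      using elim q by (intro prob_few_sites_le) auto
    also have "\<dots> \<le> ?f n"
      using q(2) by (intro add_mono mult_right_mono mult_left_mono divide_right_mono power_mono) auto
    finally show ?case .
  qed
qed (auto intro!: always_eventually)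

theorem theorem1p5:
  fixes M :: "'a measure" and Z :: "nat \<Rightarrow> 'a \<Rightarrow> int \<times> int"
  assumes "balanced_excited_random_walk M Z"
  shows "(\<forall>a :: nat \<Rightarrow> real. filterlim a at_top sequentially \<longrightarrow>
            (\<lambda>n. \<P>(\<omega> in M. real (walk_range Z n \<omega>) > real n * a n / sqrt (ln (ln (real n)))))
              \<longlonglongrightarrow> 0)
       \<and> (\<lambda>n. \<P>(\<omega> in M. real (walk_range Z n \<omega>) \<ge> real n powr (4 / 7) / (ln (real n))\<^sup>2))
            \<longlonglongrightarrow> 1"
proof -
  interpret balanced_excited_random_walk M Z
    by fact
  have law: "\<P>(\<omega> in M. Q (walk_range Z n \<omega>)) = measure_pmf.prob (walk n {} (0, 0)) {xs. Q (card (set xs))}" for Q n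
    unfolding walk_range_eq by (rule prob_path)
  have "(\<lambda>n. \<P>(\<omega> in M. real (walk_range Z n \<omega>) > real n * a n / sqrt (ln (ln (real n))))) \<longlonglongrightarrow> 0"
    if a: "filterlim a at_top sequentially" for a :: "nat \<Rightarrow> real"
  proof (rule tendsto_sandwich[where f = "\<lambda>_. 0", OF _ _ _ prob_many_sites_tendsto_0])
    have "eventually (\<lambda>n. ln (ln (real n)) > 0) sequentially"
      by real_asymp
    \<comment> \<open>A divergent \<open>a\<close> eventually exceeds the fixed constant 8 of
      \<open>prob_many_sites_tendsto_0\<close>.\<close>
    moreover have "eventually (\<lambda>n. a n \<ge> 8) sequentially"
      using a by (simp add: filterlim_at_top)
    ultimately show "eventually (\<lambda>n. \<P>(\<omega> in M. real (walk_range Z n \<omega>) > real n * a n / sqrt (ln (ln (real n))))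
       \<le> measure_pmf.prob (walk n {} (0, 0)) {xs. 8 * real n / sqrt (ln (ln (real n))) \<le> real (card (set xs))}) sequentially"
    proof eventually_elim
      case (elim n)
      have "8 * real n / sqrt (ln (ln (real n))) \<le> real n * a n / sqrt (ln (ln (real n)))"
        using elim by (intro divide_right_mono) (auto simp: mult.commute intro: mult_left_mono)
      then show ?case
        unfolding law[of "\<lambda>r. real n * a n / sqrt (ln (ln (real n))) < real r" n]
        by (intro prob_walk_mono) linarith
    qed
  qed (auto intro!: always_eventually)
  moreover have "(\<lambda>n. \<P>(\<omega> in M. real (walk_range Z n \<omega>) \<ge> real n powr (4 / 7) / (ln (real n))\<^sup>2)) \<longlonglongrightarrow> 1"
  proof -
    have "\<P>(\<omega> in M. real (walk_range Z n \<omega>) \<ge> real n powr (4 / 7) / (ln (real n))\<^sup>2) =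
        1 - measure_pmf.prob (walk n {} (0, 0)) {xs. real (card (set xs)) < real n powr (4 / 7) / (ln (real n))\<^sup>2}" for n
      unfolding law[of "\<lambda>r. real n powr (4 / 7) / (ln (real n))\<^sup>2 \<le> real r" n]
      by (subst measure_pmf.prob_compl[symmetric]) (auto intro!: arg_cong2[where f = measure] simp: not_less)
    then show ?thesis
      using tendsto_diff[OF tendsto_const prob_few_sites_tendsto_0, of 1] by simp
  qed
  ultimately show ?thesis
    by blast
qed

end
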